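(* Let $M$ be an $n\times n$ primitive Boolean matrix with Boolean rank $b=b(M)$ satisfying $3\leq b\leq n-1$. Then $$k(M)=\left\lceil\frac{(b-1)^2+1}{2}\right\rceil+1$$ if and only if $M$ has a Boolean rank factorization $M=AB$ (with $A$ an $n\times b$ and $B$ a $b\times n$ Boolean matrix) such that: (i) $BA=W_b$; (ii) some row of $A$ equals $e_{\lfloor b/2\rfloor}^t(b)$ and some row of $A$ equals $e_b^t(b)$; (iii) no column of $B$ equals $e_{b-1}(b)+e_{b}(b)$.
   Context: Boolean matrices are $(0,1)$-matrices with Boolean arithmetic ($1+1=1$). A square Boolean matrix $M$ is primitive if some power $M^r$ has all entries $1$. The scrambling index $k(M)$ of a primitive $M$ is the smallest positive integer $k$ such that any two rows of $M^k$ have a $1$ in a common position (equivalently $M^k(M^t)^k=J$, the all-ones matrix). The Boolean rank $b(M)$ is the smallest $b$ such that $M=AB$ with $A$ of size $n\times b$ and $B$ of size $b\times n$ Boolean; such a factorization is a Boolean rank factorization. $e_i(b)$ is the $i$th column of the $b\times b$ identity matrix. For $b\geq 3$, $W_b$ is the $b\times b$ $(0,1)$-matrix whose $1$ entries are exactly in positions $(i,i+1)$ for $1\leq i\leq b-1$, together with positions $(b-1,1)$ and $(b,1)$. *)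

theory Defs
  imports Complex_Main
begin

text \<open>Boolean matrices are represented as functions nat => nat => bool; a matrix of
size m x n is such a function of which only the entries (i,j) with i < m, j < n
are meaningful. Indices are 0-based: the paper's row/column i is our i - 1.\<close>

type_synonym bmat = "nat \<Rightarrow> nat \<Rightarrow> bool"

definition bmult :: "bmat \<Rightarrow> nat \<Rightarrow> bmat \<Rightarrow> bmat" where
  "bmult A k B = (\<lambda>i j. \<exists>l<k. A i l \<and> B l j)"

definition bident :: bmat where
  "bident = (\<lambda>i j. i = j)"

primrec bpow :: "nat \<Rightarrow> bmat \<Rightarrow> nat \<Rightarrow> bmat" where
  "bpow n M 0 = bident"
| "bpow n M (Suc r) = bmult (bpow n M r) n M"

definition primitive :: "nat \<Rightarrow> bmat \<Rightarrow> bool" where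
  "primitive n M \<longleftrightarrow> (\<exists>r\<ge>1. \<forall>i<n. \<forall>j<n. bpow n M r i j)"

definition scrambling_index :: "nat \<Rightarrow> bmat \<Rightarrow> nat" where
  "scrambling_index n M =
     (LEAST k. k > 0 \<and> (\<forall>i<n. \<forall>j<n. \<exists>l<n. bpow n M k i l \<and> bpow n M k j l))"

definition bfactorization :: "nat \<Rightarrow> bmat \<Rightarrow> nat \<Rightarrow> bmat \<Rightarrow> bmat \<Rightarrow> bool" where
  "bfactorization n M b A B \<longleftrightarrow> (\<forall>i<n. \<forall>j<n. M i j = bmult A b B i j)"

definition boolean_rank :: "nat \<Rightarrow> bmat \<Rightarrow> nat" where
  "boolean_rank n M = (LEAST b. \<exists>A B. bfactorization n M b A B)"

definition W :: "nat \<Rightarrow> bmat" where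
  "W b = (\<lambda>i j. (i + 1 < b \<and> j = i + 1) \<or> (i = b - 2 \<and> j = 0) \<or> (i = b - 1 \<and> j = 0))"

definition bmat_eq :: "nat \<Rightarrow> nat \<Rightarrow> bmat \<Rightarrow> bmat \<Rightarrow> bool" where
  "bmat_eq m n P Q \<longleftrightarrow> (\<forall>i<m. \<forall>j<n. P i j = Q i j)"

end

theory Submission
  imports Defs
begin

text \<open>
  If \<open>M = A B\<close> is a Boolean rank factorization, then \<open>M\<^bsup>k+1\<^esup> = A (B A)\<^bsup>k\<^esup> B\<close>, so the scrambling index
  of \<open>M\<close> exceeds that of \<open>N = B A\<close> by at most one. Put \<open>t = (b - 1)\<^sup>2 div 2\<close>.

  A primitive \<open>b \<times> b\<close> matrix \<open>N\<close> whose power \<open>N\<^sup>t\<close> has two disjoint rows is a relabelled \<open>W b\<close>.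
  If the girth is small, both walkers first go to a shortest cycle, of length \<open>s\<close>; every \<open>s\<close> further
  steps enlarge the sets they can reach, until the two sets overlap. For even \<open>b\<close> and \<open>s = b - 2\<close> this
  is too slow, and laps on cycles of lengths \<open>b - 2\<close> and \<open>b - 1\<close> are used instead. If \<open>s = b - 1\<close>,
  there is a Hamiltonian cycle with a chord, that is a copy of \<open>W b\<close>. In \<open>W b\<close> exactly one pair of rows
  is disjoint at time \<open>t\<close>; a further chord gives a rotated copy with a different such pair.

  Hence the two rows of \<open>A\<close> witnessing the maximal index must be unit vectors. Since \<open>b - 2\<close> and
  \<open>b - 1\<close> are the only two vertices of \<open>W b\<close> with a common successor, a column of \<open>B\<close> with two ones has
  them exactly there, and such a column would let the two rows meet one step earlier.
\<close>

text \<open>The scrambling index is the least positive \<open>t\<close> at which this holds for all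
  pairs; keeping the pair explicit makes it possible to single out a slowest pair.\<close>

definition meets :: "nat \<Rightarrow> bmat \<Rightarrow> nat \<Rightarrow> nat \<Rightarrow> nat \<Rightarrow> bool" where
  "meets n M t i j \<longleftrightarrow> (\<exists>l<n. bpow n M t i l \<and> bpow n M t j l)"

text \<open>The cycle is a periodic function on all naturals, so walks along it and rotations need
  no index reduction. The equivalence encodes period and injectivity at once.\<close>

definition simple_cycle :: "nat \<Rightarrow> bmat \<Rightarrow> nat \<Rightarrow> (nat \<Rightarrow> nat) \<Rightarrow> bool" where
  "simple_cycle n M m c \<longleftrightarrow> 0 < m \<and> (\<forall>i. c i < n) \<and> (\<forall>i. M (c i) (c (Suc i)))
     \<and> (\<forall>i j. c i = c j \<longleftrightarrow> i mod m = j mod m)"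

section \<open>Walks\<close>

lemma bpow_add:
  assumes "j < n"
  shows "bpow n M (a + b) i j \<longleftrightarrow> (\<exists>l<n. bpow n M a i l \<and> bpow n M b l j)"
  using assms
proof (induction b arbitrary: j)
  case 0
  then show ?case by (auto simp: bident_def)
next
  case (Suc b)
  have "bpow n M (a + Suc b) i j \<longleftrightarrow> (\<exists>k<n. bpow n M (a + b) i k \<and> M k j)"
    by (simp add: bmult_def)
  also have "\<dots> \<longleftrightarrow> (\<exists>k<n. (\<exists>l<n. bpow n M a i l \<and> bpow n M b l k) \<and> M k j)"
    using Suc.IH by blast
  also have "\<dots> \<longleftrightarrow> (\<exists>l<n. bpow n M a i l \<and> bpow n M (Suc b) l j)"
    by (auto simp: bmult_def)
  finally show ?case .
qed

lemma bpow_trans: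
  "bpow n M a i l \<Longrightarrow> bpow n M b l j \<Longrightarrow> l < n \<Longrightarrow> j < n \<Longrightarrow> bpow n M (a + b) i j"
  by (auto simp: bpow_add)

lemma bident_refl [simp]: "bident i i"
  by (simp add: bident_def)

lemma bpow_1: "i < n \<Longrightarrow> bpow n M (Suc 0) i j \<longleftrightarrow> M i j"
  by (auto simp: bmult_def bident_def)

lemma bpow_Suc_left:
  "i < n \<Longrightarrow> j < n \<Longrightarrow> bpow n M (Suc t) i j \<longleftrightarrow> (\<exists>l<n. M i l \<and> bpow n M t l j)"
  using bpow_add[of j n M "Suc 0" t i] bpow_1[of i n M] by simp

lemma bpow_laps:
  assumes "bpow n M m x x" "x < n"
  shows "bpow n M (k * m) x x"
proof (induction k)
  case (Suc k)
  show ?case using bpow_trans[OF assms(1) Suc assms(2) assms(2)] by simp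
qed simp

lemma bpow_cong:
  assumes "\<And>i j. i < n \<Longrightarrow> j < n \<Longrightarrow> M i j = M' i j" "i < n" "j < n"
  shows "bpow n M t i j = bpow n M' t i j"
  using assms(3)
proof (induction t arbitrary: j)
  case (Suc t)
  then show ?case using assms(1) by (auto simp: bmult_def)
qed simp

lemma bpow_hom:
  assumes "\<And>i j. i < n \<Longrightarrow> j < n \<Longrightarrow> M i j \<Longrightarrow> M' (f i) (f j)"
    and "\<And>i. i < n \<Longrightarrow> f i < m" and "bpow n M t i j" "i < n" "j < n"
  shows "bpow m M' t (f i) (f j)"
  using assms(3,5)
proof (induction t arbitrary: j)
  case 0
  then show ?case by (auto simp: bident_def)
next
  case (Suc t)
  then obtain l where "l < n" "bpow n M t i l" "M l j" by (auto simp: bmult_def)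
  then have "bpow m M' t (f i) (f l)" "M' (f l) (f j)" "f l < m"
    using Suc.IH Suc.prems(2) assms(1,2) by auto
  then show ?case by (auto simp: bmult_def)
qed

lemma bpow_path:
  assumes "bpow n M t x y" "x < n" "y < n"
  shows "\<exists>c. c 0 = x \<and> c t = y \<and> (\<forall>i\<le>t. c i < n) \<and> (\<forall>i<t. M (c i) (c (Suc i)))"
  using assms(1,3)
proof (induction t arbitrary: y)
  case 0
  then show ?case using assms(2) by (auto simp: bident_def)
next
  case (Suc t)
  then obtain l where l: "l < n" "bpow n M t x l" "M l y" by (auto simp: bmult_def)
  then obtain c where c: "c 0 = x" "c t = l" "\<forall>i\<le>t. c i < n" "\<forall>i<t. M (c i) (c (Suc i))"
    using Suc.IH by blast
  define c' where "c' = c(Suc t := y)"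
  have "c' 0 = x" "c' (Suc t) = y" using c by (auto simp: c'_def)
  moreover have "\<forall>i\<le>Suc t. c' i < n" using c Suc.prems by (auto simp: c'_def le_Suc_eq)
  moreover have "\<forall>i<Suc t. M (c' i) (c' (Suc i))"
    using c l by (auto simp: c'_def less_Suc_eq)
  ultimately show ?case by blast
qed

lemma path_bpow:
  assumes "\<And>i. i \<le> t \<Longrightarrow> c i < n" "\<And>i. i < t \<Longrightarrow> M (c i) (c (Suc i))" "i + k \<le> t"
  shows "bpow n M k (c i) (c (i + k))"
  using assms(3)
proof (induction k)
  case (Suc k)
  then show ?case using assms(1)[of "i + k"] assms(2)[of "i + k"]
    by (auto simp: bmult_def)
qed simp

section \<open>Common endpoints of two walks of equal length\<close>

lemma meets_sym: "meets n M t i j \<longleftrightarrow> meets n M t j i"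
  by (auto simp: meets_def)

lemma meets_walks:
  assumes "bpow n M k i i'" "bpow n M k j j'" "meets n M t i' j'" "i' < n" "j' < n"
  shows "meets n M (k + t) i j"
  using assms by (meson bpow_trans meets_def)

lemma meets_step:
  assumes "M i i'" "M j j'" "meets n M t i' j'" "i < n" "j < n" "i' < n" "j' < n"
  shows "meets n M (Suc t) i j"
  using meets_walks[of n M "Suc 0" i i' j j' t] assms by (simp add: bpow_1 del: bpow.simps)

text \<open>Two walkers that have met can continue together, since no row is empty.\<close>

lemma meets_mono:
  assumes "\<And>i. i < n \<Longrightarrow> \<exists>j<n. M i j" "meets n M t i j" "t \<le> t'"
  shows "meets n M t' i j"
  using assms(3)
proof (induction t' rule: dec_induct)
  case base
  show ?case by (rule assms(2))
next
  case (step t')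
  then obtain l where l: "l < n" "bpow n M t' i l" "bpow n M t' j l" by (auto simp: meets_def)
  obtain k where "k < n" "M l k" using assms(1) l(1) by blast
  with l show ?case by (auto simp: meets_def bmult_def)
qed

section \<open>Simple cycles\<close>

lemma simple_cycleD:
  assumes "simple_cycle n M m c"
  shows "0 < m" "c i < n" "M (c i) (c (Suc i))" "c i = c j \<longleftrightarrow> i mod m = j mod m"
  using assms by (auto simp: simple_cycle_def)

lemma simple_cycle_bpow: "simple_cycle n M m c \<Longrightarrow> bpow n M k (c i) (c (i + k))"
  by (rule path_bpow[where t = "i + k"]) (auto simp: simple_cycle_def)

lemma simple_cycle_period [simp]: "simple_cycle n M m c \<Longrightarrow> c (i + m) = c i"
  by (simp add: simple_cycleD(4))

lemma simple_cycle_closed: "simple_cycle n M m c \<Longrightarrow> bpow n M m (c i) (c i)"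
  using simple_cycle_bpow[of n M m c m i] by simp

lemma mod_add_eq_cancel: "(i + k) mod m = (j + k) mod m \<longleftrightarrow> i mod m = j mod (m::nat)"
  by (auto simp: nat_mod_eq_iff)

lemma simple_cycle_shift:
  assumes "simple_cycle n M m c"
  shows "simple_cycle n M m (\<lambda>i. c (i + k))"
  using assms by (auto simp: simple_cycle_def mod_add_eq_cancel)

lemma simple_cycle_neq:
  assumes "simple_cycle n M m c" "0 < k" "k < m"
  shows "c (i + k) \<noteq> c i"
proof
  assume "c (i + k) = c i"
  then have "(k + i) mod m = (0 + i) mod m" using simple_cycleD(4)[OF assms(1)] by (simp add: add.commute)
  then have "k mod m = 0 mod m" by (simp only: mod_add_eq_cancel)
  then show False using assms by simp
qed

lemma simple_cycle_range:
  assumes "simple_cycle n M m c"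
  shows "range c = c ` {..<m}" "card (range c) = m" "range c \<subseteq> {..<n}" "m \<le> n"
proof -
  note c = simple_cycleD[OF assms]
  have "c i \<in> c ` {..<m}" for i
    using c(1) c(4)[of i "i mod m"] by (intro image_eqI[of _ _ "i mod m"]) auto
  then show *: "range c = c ` {..<m}" by auto
  have "inj_on c {..<m}" using c(4) by (auto simp: inj_on_def)
  then show card: "card (range c) = m" unfolding * by (simp add: card_image)
  show sub: "range c \<subseteq> {..<n}" using c(2) by auto
  show "m \<le> n" using card_mono[OF _ sub] card by simp
qed

text \<open>Of the two arcs joining the vertices, one has at most half the length of the
  cycle.\<close>

lemma simple_cycle_distance:
  assumes "simple_cycle n M m c" "x \<in> range c" "y \<in> range c" "x \<noteq> y"
  shows "\<exists>i d. 0 < d \<and> 2 * d \<le> m \<and>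
    (x = c i \<and> y = c (i + d) \<or> y = c i \<and> x = c (i + d))"
proof -
  have *: "\<exists>i d. 0 < d \<and> 2 * d \<le> m \<and>
    (x = c i \<and> y = c (i + d) \<or> y = c i \<and> x = c (i + d))"
    if "x = c i" "y = c j" "i < j" "j < m" for x y i j
  proof (cases "2 * (j - i) \<le> m")
    case True
    then show ?thesis using that by (intro exI[of _ i] exI[of _ "j - i"]) auto
  next
    case False
    then have "x = c (j + (m - (j - i)))"
      using that simple_cycle_period[OF assms(1), of i] by (simp add: add.commute)
    then show ?thesis using that False
      by (intro exI[of _ j] exI[of _ "m - (j - i)"]) auto
  qed
  obtain i j where ij: "x = c i" "y = c j" "i < m" "j < m"
    using assms(2,3) simple_cycle_range(1)[OF assms(1)] by auto
  then have "i \<noteq> j" using assms(4) by auto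
  then consider "i < j" | "j < i" by linarith
  then show ?thesis
  proof cases
    case 1
    then show ?thesis using *[of x i y j] ij by blast
  next
    case 2
    then show ?thesis using *[of y j x i] ij by blast
  qed
qed

text \<open>A closed walk of least length with property \<open>P\<close> is simple: a repeated
  vertex would cut it into two shorter closed walks, one of which has \<open>P\<close> again by
  \<open>split\<close>.\<close>

lemma simple_cycle_exists:
  assumes "P m" "0 < m" "x < n" "bpow n M m x x"
    and split: "\<And>a b. P (a + b) \<Longrightarrow> 0 < a \<Longrightarrow> 0 < b \<Longrightarrow> P a \<or> P b"
  shows "\<exists>m c. P m \<and> simple_cycle n M m c \<and>
    (\<forall>m'>0. \<forall>x<n. bpow n M m' x x \<longrightarrow> P m' \<longrightarrow> m \<le> m')"
proof -
  define Q where "Q m \<longleftrightarrow> P m \<and> 0 < m \<and> (\<exists>x<n. bpow n M m x x)" for m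
  define m0 where "m0 = (LEAST m. Q m)"
  have "Q m" using assms by (auto simp: Q_def)
  then have Q: "Q m0" and least: "\<And>m. Q m \<Longrightarrow> m0 \<le> m"
    unfolding m0_def by (auto intro: LeastI Least_le)
  obtain x where x: "x < n" "bpow n M m0 x x" using Q by (auto simp: Q_def)
  obtain c where c: "c 0 = x" "c m0 = x" "\<forall>i\<le>m0. c i < n" "\<forall>i<m0. M (c i) (c (Suc i))"
    using bpow_path[OF x(2) x(1) x(1)] by blast
  have m0: "0 < m0" "P m0" using Q by (auto simp: Q_def)
  have sub: "bpow n M k (c i) (c (i + k))" if "i + k \<le> m0" for i k
    by (rule path_bpow[where t = m0]) (use c that in auto)
  have inj: "c i \<noteq> c j" if "i < j" "j < m0" for i j
  proof
    assume eq: "c i = c j"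
    have lt: "c i < n" using c(3) that by auto
    have 1: "bpow n M (j - i) (c i) (c i)" using sub[of i "j - i"] that eq by simp
    \<comment> \<open>Cutting out the segment from \<open>i\<close> to \<open>j\<close> leaves the
      rest of the closed walk, read from \<open>c i\<close>.\<close>
    have "bpow n M (m0 - j) (c i) x" using sub[of j "m0 - j"] that eq c by simp
    moreover have "bpow n M i x (c i)" using sub[of 0 i] that c by simp
    ultimately have "bpow n M (m0 - j + i) (c i) (c i)"
      using bpow_trans[of n M "m0 - j" "c i" x i] x lt by blast
    then have 2: "bpow n M (m0 - (j - i)) (c i) (c i)" using that by (simp add: algebra_simps)
    have "P (j - i) \<or> P (m0 - (j - i))" using split[of "j - i" "m0 - (j - i)"] that m0 by auto
    then have "Q (j - i) \<or> Q (m0 - (j - i))" using 1 2 lt that by (auto simp: Q_def)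
    then show False using least[of "j - i"] least[of "m0 - (j - i)"] that by auto
  qed
  define e where "e i = c (i mod m0)" for i
  have "e i < n" for i using c(3) m0 by (auto simp: e_def intro: less_imp_le)
  moreover have "M (e i) (e (Suc i))" for i
  proof (cases "Suc (i mod m0) = m0")
    case True
    then have "e (Suc i) = c m0" using c by (simp add: e_def mod_Suc)
    then show ?thesis using True c(4) m0 by (metis e_def lessI)
  next
    case False
    then have "e (Suc i) = c (Suc (i mod m0))" by (simp add: e_def mod_Suc)
    then show ?thesis using c(4) m0 by (simp add: e_def)
  qed
  moreover have "e i = e j \<longleftrightarrow> i mod m0 = j mod m0" for i j
    using inj[of "i mod m0" "j mod m0"] inj[of "j mod m0" "i mod m0"] m0
    unfolding e_def by (metis linorder_neqE_nat mod_less_divisor)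
  ultimately have "simple_cycle n M m0 e" using m0 by (auto simp: simple_cycle_def)
  moreover have "\<forall>m'>0. \<forall>x<n. bpow n M m' x x \<longrightarrow> P m' \<longrightarrow> m0 \<le> m'"
    using least by (auto simp: Q_def)
  ultimately show ?thesis using m0 by blast
qed

section \<open>The Wielandt matrix\<close>

text \<open>One less than the scrambling index of \<open>W n\<close>.\<close>
definition wt :: "nat \<Rightarrow> nat" where
  "wt n = (n - 1)\<^sup>2 div 2"

lemma wt_odd: "wt (2 * h + 1) = 2 * h * h"
  by (simp add: wt_def power2_eq_square)

lemma wt_even: "wt (2 * h) = 2 * h * (h - 1)"
proof (cases h)
  case (Suc k)
  have "(2 * h - 1)\<^sup>2 = 2 * (2 * h * (h - 1)) + 1"
    using Suc by (simp add: power2_eq_square algebra_simps)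
  then show ?thesis by (simp add: wt_def)
qed (simp add: wt_def)

section \<open>Meeting times in the Wielandt digraph\<close>

lemma W_bpow_cycle:
  assumes "i < n"
  shows "bpow n (W n) k i ((i + k) mod n)"
proof (induction k)
  case 0
  then show ?case using assms by simp
next
  case (Suc k)
  have "W n ((i + k) mod n) ((i + Suc k) mod n)"
    using assms mod_less_divisor[of n "i + k"] by (auto simp: W_def mod_Suc simp del: mod_less_divisor)
  moreover have "(i + k) mod n < n" using assms by simp
  ultimately show ?case using Suc by (auto simp: bmult_def)
qed

text \<open>The edge from \<open>n - 2\<close> to \<open>0\<close> closes a cycle through all
  vertices except \<open>n - 1\<close>.\<close>

lemma W_bpow_lap:
  assumes "i + 1 < n"
  shows "bpow n (W n) (n - 1) i i"
proof -
  have 1: "bpow n (W n) (n - 2 - i) i (n - 2)"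
    using W_bpow_cycle[of i n "n - 2 - i"] assms by simp
  have 2: "bpow n (W n) (Suc 0) (n - 2) 0"
    using assms by (simp add: bpow_1 W_def del: bpow.simps)
  have 3: "bpow n (W n) i 0 i"
    using W_bpow_cycle[of 0 n i] assms by simp
  have "bpow n (W n) (n - 2 - i + Suc 0 + i) i i"
    using bpow_trans[OF bpow_trans[OF 1 2] 3] assms by simp
  then show ?thesis using assms by (simp add: Suc_diff_Suc)
qed

text \<open>One walker does \<open>d\<close> laps of the cycle of length \<open>n - 1\<close>, while the other
  follows the Hamiltonian cycle.\<close>
lemma W_meets_distance:
  assumes "x + 1 < n"
  shows "meets n (W n) (d * (n - 1)) x ((x + d) mod n)"
proof -
  \<comment> \<open>The head start \<open>d\<close> and \<open>d * (n - 1)\<close> steps add up to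
    \<open>d\<close> full Hamiltonian laps from \<open>x\<close>.\<close>
  have "((x + d) mod n + d * (n - 1)) mod n = (x + d * n) mod n"
    using assms by (cases n) (auto simp: mod_simps algebra_simps)
  also have "\<dots> = x" using assms by simp
  finally have "bpow n (W n) (d * (n - 1)) ((x + d) mod n) x"
    using W_bpow_cycle[of "(x + d) mod n" n "d * (n - 1)"] assms by simp
  moreover have "bpow n (W n) (d * (n - 1)) x x"
    using bpow_laps[OF W_bpow_lap] assms by simp
  ultimately show ?thesis unfolding meets_def using assms by (intro exI[of _ x]) simp
qed

lemma W_row_nonzero: "i < n \<Longrightarrow> 2 \<le> n \<Longrightarrow> \<exists>j<n. W n i j"
  by (cases "i + 1 < n") (auto simp: W_def intro: exI[of _ "i + 1"] exI[of _ 0])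

text \<open>The proof goes by cyclic distance. A walker not at \<open>n - 1\<close> that trails by
  \<open>d < n / 2\<close> meets the other after \<open>d * (n - 1)\<close> steps. If the trailing
  walker is at \<open>n - 1\<close>, or the two are antipodal, some preliminary steps restore this
  situation.\<close>

lemma W_meets_wt:
  assumes n: "3 \<le> n" and ij: "i < n" "j < n"
    and ne: "{i, j} \<noteq> {n div 2 - 1, n - 1}"
  shows "meets n (W n) (wt n) i j"
proof -
  have mono: "meets n (W n) (wt n) x y" if "meets n (W n) t x y" "t \<le> wt n" for t x y
    using meets_mono[OF W_row_nonzero] that n by simp
  have main: "meets n (W n) (wt n) i j" if lt: "i < j" and j: "j < n"
    and ne: "{i, j} \<noteq> {n div 2 - 1, n - 1}" for i j
  proof -
    obtain h where h: "n = 2 * h \<or> n = 2 * h + 1" by (meson oddE evenE)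
    have short: "d * (n - 1) \<le> wt n" if "2 * d < n" for d
      using h
    proof
      assume h: "n = 2 * h"
      then obtain k where k: "h = Suc k" using n by (cases h) auto
      have "d * (n - 1) \<le> k * (n - 1)" using that h k by (intro mult_right_mono) auto
      also have "\<dots> \<le> wt n" unfolding h wt_even k by (simp add: algebra_simps)
      finally show ?thesis .
    next
      assume h: "n = 2 * h + 1"
      have "d * (n - 1) \<le> h * (n - 1)" using that h by (intro mult_right_mono) auto
      also have "\<dots> \<le> wt n" unfolding h wt_odd by (simp add: algebra_simps)
      finally show ?thesis .
    qed
    consider "2 * (j - i) < n" | "n < 2 * (j - i)" "j + 1 < n" | "n < 2 * (j - i)" "j = n - 1"
      | "2 * (j - i) = n" using j by linarith
    then show ?thesis
    proof cases
      case 1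
      then have "meets n (W n) ((j - i) * (n - 1)) i j"
        using W_meets_distance[of i n "j - i"] lt j by simp
      then show ?thesis using short 1 mono by blast
    next
      case 2
      define e where "e = n - (j - i)"
      have "(j + e) mod n = i" using lt j by (simp add: e_def)
      then have "meets n (W n) (e * (n - 1)) j i"
        using W_meets_distance[of j n e] 2 by simp
      moreover have "2 * e < n" using 2 by (simp add: e_def)
      ultimately show ?thesis using short mono meets_sym by blast
    next
      case 3
      \<comment> \<open>As \<open>n - 1\<close> lies off the short cycle, both walkers first take
        one step, to \<open>0\<close> and \<open>i + 1\<close>.\<close>
      define e where "e = i + 1"
      have e: "2 * e < n" "e < n" using 3 by (auto simp: e_def)
      have "meets n (W n) (e * (n - 1)) 0 e"
        using W_meets_distance[of 0 n e] e n by simp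
      moreover have "W n i e" "W n j 0" using 3 e by (auto simp: W_def e_def)
      ultimately have *: "meets n (W n) (Suc (e * (n - 1))) i j"
        using meets_step[of "W n" i e j 0 n] e j lt meets_sym by auto
      have "Suc (e * (n - 1)) \<le> wt n"
        using h
      proof
        assume h: "n = 2 * h"
        then have "2 \<le> h" using n by simp
        then obtain k where k: "h = 2 + k" using le_Suc_ex by blast
        have "e * (n - 1) \<le> (k + 1) * (n - 1)" using e h k by (intro mult_right_mono) auto
        also have "\<dots> < wt n" unfolding h wt_even k by (simp add: algebra_simps)
        finally show ?thesis by simp
      next
        assume h: "n = 2 * h + 1"
        \<comment> \<open>Equality would make \<open>i = n div 2 - 1\<close>, the excluded
          pair.\<close>
        have "e \<noteq> h" using ne 3 h by (auto simp: e_def)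
        then have "e < h" using e h by simp
        then obtain k where k: "h = Suc k" by (cases h) auto
        have "e * (n - 1) \<le> k * (n - 1)" using \<open>e < h\<close> k by (intro mult_right_mono) auto
        also have "\<dots> < wt n" unfolding h wt_odd k by (simp add: algebra_simps)
        finally show ?thesis by simp
      qed
      then show ?thesis using * mono by blast
    next
      case 4
      then have "n = 2 * h" using h by presburger
      then have h: "n = 2 * h" "j = i + h" using 4 lt by auto
      have "i \<noteq> h - 1" using ne h n by auto
      then have i: "i + 2 \<le> h" using j h by linarith
      \<comment> \<open>Antipodal walkers go on to \<open>h - 2\<close> and \<open>n - 2\<close>;
        there the chord shortens their distance from \<open>h\<close> to
        \<open>h - 1\<close>.\<close>
      have 1: "meets n (W n) ((h - 1) * (n - 1)) 0 (h - 1)"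
        using W_meets_distance[of 0 n "h - 1"] h n by simp
      have "W n (n - 2) 0" "W n (h - 2) (h - 1)" using h i by (auto simp: W_def)
      then have 2: "meets n (W n) (Suc ((h - 1) * (n - 1))) (h - 2) (n - 2)"
        using meets_step[of "W n" "h - 2" "h - 1" "n - 2" 0 n] 1 h n meets_sym by auto
      have "bpow n (W n) (h - 2 - i) i (h - 2)" "bpow n (W n) (h - 2 - i) j (n - 2)"
        using W_bpow_cycle[of i n "h - 2 - i"] W_bpow_cycle[of j n "h - 2 - i"] h i by (auto simp: mult_2)
      then have 3: "meets n (W n) (h - 2 - i + Suc ((h - 1) * (n - 1))) i j"
        using meets_walks[OF _ _ 2] h n by simp
      have "2 \<le> h" using i by simp
      then obtain k where k: "h = 2 + k" using le_Suc_ex by blast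
      have "h - 2 - i + Suc ((h - 1) * (n - 1)) \<le> k + Suc ((h - 1) * (n - 1))" using k by simp
      also have "\<dots> \<le> wt n" unfolding h(1) wt_even k by (simp add: algebra_simps)
      finally show ?thesis using 3 mono by blast
    qed
  qed
  consider "i < j" | "j < i" | "i = j" by linarith
  then show ?thesis
  proof cases
    case 1 then show ?thesis using main ne ij by blast
  next
    case 2 then show ?thesis using main[of j i] ne ij meets_sym by (simp add: insert_commute)
  next
    case 3
    then have "meets n (W n) 0 i j" using ij by (auto simp: meets_def)
    then show ?thesis using mono by simp
  qed
qed

text \<open>One step takes the exceptional pair to \<open>n div 2\<close> and \<open>0\<close>,
  which meet within \<open>wt n\<close> steps.\<close>

lemma W_meets_Suc_wt:
  assumes n: "3 \<le> n" and ij: "i < n" "j < n"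
  shows "meets n (W n) (Suc (wt n)) i j"
proof -
  have *: "meets n (W n) (Suc (wt n)) (n div 2 - 1) (n - 1)"
  proof -
    have "W n (n div 2 - 1) (n div 2)" "W n (n - 1) 0" using n by (auto simp: W_def)
    moreover have "meets n (W n) (wt n) (n div 2) 0"
      using n by (intro W_meets_wt) (auto simp: doubleton_eq_iff)
    ultimately show ?thesis using n by (intro meets_step) auto
  qed
  show ?thesis
  proof (cases "{i, j} = {n div 2 - 1, n - 1}")
    case True
    then show ?thesis using * meets_sym by (auto simp: doubleton_eq_iff)
  next
    case False
    then show ?thesis
      using meets_mono[OF W_row_nonzero W_meets_wt[OF n ij]] n by simp
  qed
qed

text \<open>A walk of length \<open>t\<close> that uses the edge from \<open>n - 2\<close> to \<open>0\<close> exactly \<open>c\<close> times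
  advances by \<open>t + c\<close> along the Hamiltonian cycle and winds around \<open>q\<close> times.\<close>
lemma W_bpow_winding:
  assumes "bpow n (W n) t i j" "i < n" "j < n" "2 \<le> n"
  shows "\<exists>c q. i + t + c = j + q * n \<and> c \<le> q \<and> (i = n - 1 \<longrightarrow> 0 < t \<longrightarrow> c < q)"
  using assms(1,3)
proof (induction t arbitrary: j)
  case 0
  then have "i + 0 + 0 = j + 0 * n" by (simp add: bident_def)
  then show ?case by blast
next
  case (Suc t)
  then obtain l where l: "l < n" "bpow n (W n) t i l" "W n l j" by (auto simp: bmult_def)
  then obtain c q where cq: "i + t + c = l + q * n" "c \<le> q"
    "i = n - 1 \<longrightarrow> 0 < t \<longrightarrow> c < q" using Suc.IH by blast
  consider "j = l + 1" | "l = n - 2" "j = 0" | "l = n - 1" "j = 0"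
    using l(3) by (auto simp: W_def)
  then show ?case
  proof cases
    case 1
    \<comment> \<open>At time \<open>0\<close> the induction hypothesis gives no strict inequality,
      but then the walk would be at \<open>n - 1\<close>, where this kind of step is
      impossible.\<close>
    have "c < q" if "i = n - 1"
    proof (cases "t = 0")
      case True
      then have "l = i" using l by (auto simp: bident_def)
      then show ?thesis using 1 that Suc.prems assms(4) by simp
    qed (use cq that in auto)
    then show ?thesis using 1 cq by (intro exI[of _ c] exI[of _ q]) auto
  next
    case 2
    have "c < q" if "i = n - 1"
    proof (cases "t = 0")
      case True
      then have "l = i" using l by (auto simp: bident_def)
      then show ?thesis using 2 that assms(4) by simp
    qed (use cq that in auto)
    then show ?thesis using 2 cq assms(4) by (intro exI[of _ "c + 1"] exI[of _ "q + 1"]) auto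
  next
    case 3
    then show ?thesis using cq assms(4) by (intro exI[of _ c] exI[of _ "q + 1"]) auto
  qed
qed

text \<open>If the walks ended at the same vertex, their numbers of chord uses would have to make up
  for the distance between the starting points. The time \<open>wt n\<close> allows too few uses for
  that.\<close>

lemma W_not_meets_wt:
  assumes n: "3 \<le> n"
  shows "\<not> meets n (W n) (wt n) (n div 2 - 1) (n - 1)"
proof
  assume "meets n (W n) (wt n) (n div 2 - 1) (n - 1)"
  then obtain l where l: "l < n" "bpow n (W n) (wt n) (n div 2 - 1) l" "bpow n (W n) (wt n) (n - 1) l"
    by (auto simp: meets_def)
  obtain h where h: "n = 2 * h \<or> n = 2 * h + 1" by (meson oddE evenE)
  have hd: "n div 2 = h" and h1: "1 \<le> h" and "h - 1 < n" using h n by auto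
  obtain k where k: "h = Suc k" using h1 by (cases h) auto
  have big: "h - 1 + wt n < (n - h) * (n - 1)" and big': "wt n < h * (n - 1) + 1" and "0 < wt n"
    using h
  proof (safe)
    assume "n = 2 * h"
    then show "h - 1 + wt (2 * h) < (2 * h - h) * (2 * h - 1)" "wt (2 * h) < h * (2 * h - 1) + 1"
      "0 < wt (2 * h)" unfolding wt_even k using n k by (simp_all add: algebra_simps)
  next
    show "h - 1 + wt (2 * h + 1) < (2 * h + 1 - h) * (2 * h + 1 - 1)"
      "wt (2 * h + 1) < h * (2 * h + 1 - 1) + 1" "0 < wt (2 * h + 1)"
      unfolding wt_odd k by (simp_all add: algebra_simps)
  qed
  obtain c q where 1: "h - 1 + wt n + c = l + q * n" "c \<le> q"
    using W_bpow_winding[OF l(2)] l(1) n \<open>h - 1 < n\<close> unfolding hd by fastforce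
  obtain c' q' where 2: "n - 1 + wt n + c' = l + q' * n" "c' < q'"
    using W_bpow_winding[OF l(3)] l(1) n \<open>0 < wt n\<close> by auto
  have lap: "x * n = x * (n - 1) + x" for x using n by (cases n) auto
  \<comment> \<open>Each use of the chord comes with a winding, so it costs \<open>n - 1\<close>
    steps.\<close>
  have "c * n \<le> q * n" using 1 by simp
  then have "c * (n - 1) \<le> h - 1 + wt n" using 1 lap[of c] by linarith
  then have "c * (n - 1) < (n - h) * (n - 1)" using big by linarith
  then have c: "c < n - h" by simp
  \<comment> \<open>From \<open>n - 1\<close> there is one winding without the chord, so at least
    \<open>Suc c'\<close> windings in all.\<close>
  have "Suc c' * n \<le> q' * n" using 2 by (intro mult_right_mono) auto
  then have "c' * (n - 1) + 1 \<le> wt n" using 2 lap[of c'] n by simp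
  then have "c' * (n - 1) < h * (n - 1)" using big' by linarith
  then have c': "c' < h" by simp
  \<comment> \<open>The common endpoint is eliminated. Now \<open>q' \<le> q\<close> would need
    \<open>c \<ge> n - h\<close>, and \<open>q < q'\<close> would need
    \<open>c' \<ge> h\<close>.\<close>
  have eq: "h - 1 + c + q' * n = n - 1 + c' + q * n" using 1 2 by linarith
  show False
  proof (cases "q' \<le> q")
    case True
    then have "q' * n \<le> q * n" by simp
    then show False using eq c n h1 by linarith
  next
    case False
    then have "Suc q * n \<le> q' * n" by (intro mult_right_mono) auto
    then show False using eq c' n h1 by simp
  qed
qed

section \<open>Primitive matrices with a large scrambling index\<close>

text \<open>Each set determines the next, so a chain that pauses once is constant from then on and
  must already be \<open>V\<close>. Before that every step adds an element.\<close>

lemma card_chain_ge: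
  assumes "finite V" "\<And>j. F j \<subseteq> F (Suc j)" "\<And>j. F (Suc j) = G (F j)" "\<And>j. F j \<subseteq> V" "F J = V"
  shows "min (card V) (card (F 0) + j) \<le> card (F j)"
proof (induction j)
  case (Suc j)
  show ?case
  proof (cases "F (Suc j) = F j")
    case True
    have "F (j + k) = F j" for k
    proof (induction k)
      case (Suc k)
      then show ?case using True assms(3)[of "j + k"] assms(3)[of j] by simp
    qed simp
    moreover have "mono F" using assms(2) by (simp add: mono_iff_le_Suc)
    ultimately have "V \<subseteq> F (Suc j)" using assms(5) True
      by (metis le_add2 monoD subset_refl)
    then have "F (Suc j) = V" using assms(4) by blast
    then show ?thesis by simp
  next
    case False
    then have "F j \<subset> F (Suc j)" using assms(2) by blast
    moreover have "finite (F (Suc j))" using assms(1,4) finite_subset by blast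
    ultimately have "card (F j) < card (F (Suc j))" by (rule psubset_card_mono[rotated])
    then show ?thesis using Suc by linarith
  qed
qed simp

locale primitive_matrix =
  fixes n :: nat and N :: bmat
  assumes primitive: "primitive n N"
begin

section \<open>Walks and cycles in a primitive digraph\<close>

lemma row_nonzero:
  assumes "i < n"
  shows "\<exists>j<n. N i j"
proof -
  obtain r where r: "1 \<le> r" "bpow n N r i i" using primitive assms by (auto simp: primitive_def)
  then obtain r' where "r = Suc r'" by (cases r) auto
  then show ?thesis using r assms by (auto simp: bpow_Suc_left simp del: bpow.simps)
qed

lemma col_nonzero:
  assumes "j < n"
  shows "\<exists>i<n. N i j"
proof -
  obtain r where r: "1 \<le> r" "bpow n N r j j" using primitive assms by (auto simp: primitive_def)
  then obtain r' where "r = Suc r'" by (cases r) auto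
  then show ?thesis using r by (auto simp: bmult_def)
qed

lemma meets_later: "meets n N t i j \<Longrightarrow> t \<le> t' \<Longrightarrow> meets n N t' i j"
  by (rule meets_mono[OF row_nonzero])

lemma meets_self:
  assumes "i < n"
  shows "meets n N t i i"
proof -
  have "meets n N 0 i i" using assms by (auto simp: meets_def)
  then show ?thesis by (rule meets_later) simp
qed

text \<open>A full power stays full after multiplication by \<open>N\<close>, as no column of
  \<open>N\<close> is empty.\<close>

lemma eventually_full: "\<exists>r\<ge>1. \<forall>t\<ge>r. \<forall>i<n. \<forall>j<n. bpow n N t i j"
proof -
  obtain r where r: "1 \<le> r" "\<forall>i<n. \<forall>j<n. bpow n N r i j"
    using primitive by (auto simp: primitive_def)
  have "\<forall>i<n. \<forall>j<n. bpow n N t i j" if "r \<le> t" for t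
    using that
  proof (induction t rule: dec_induct)
    case (step t)
    show ?case
    proof (intro allI impI)
      fix i j assume "i < n" "j < n"
      then obtain l where "l < n" "N l j" using col_nonzero by blast
      then show "bpow n N (Suc t) i j" using step \<open>i < n\<close> by (auto simp: bmult_def)
    qed
  qed (use r in simp)
  then show ?thesis using r(1) by blast
qed

lemma shortest_cycle:
  assumes "0 < n"
  shows "\<exists>s c. simple_cycle n N s c \<and> (\<forall>m>0. \<forall>x<n. bpow n N m x x \<longrightarrow> s \<le> m)"
proof -
  obtain r where "1 \<le> r" "bpow n N r 0 0" using assms primitive by (auto simp: primitive_def)
  then show ?thesis
    using simple_cycle_exists[where P = "\<lambda>_. True" and m = r and x = 0 and n = n and M = N] assms
    by simp
qed

text \<open>Closed walks of lengths \<open>r\<close> and \<open>r + 1\<close> exist for some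
  \<open>r\<close>, and \<open>p\<close> cannot divide both lengths. When a closed walk is split,
  non-divisibility by \<open>p\<close> passes to one of the parts.\<close>

lemma nondivisible_cycle:
  assumes "0 < n" "2 \<le> p"
  shows "\<exists>m c. \<not> p dvd m \<and> simple_cycle n N m c"
proof -
  obtain r where r: "r \<ge> 1" "\<forall>t\<ge>r. \<forall>i<n. \<forall>j<n. bpow n N t i j" using eventually_full by blast
  have "\<not> p dvd r \<or> \<not> p dvd Suc r"
    using assms(2) dvd_diff_nat[of p "Suc r" r] by auto
  then obtain t where "t \<ge> r" "\<not> p dvd t" using le_SucI by blast
  then show ?thesis
    using simple_cycle_exists[where P = "\<lambda>m. \<not> p dvd m" and m = t and x = 0 and n = n and M = N] r assms dvd_add
    by (metis le_trans less_le_trans zero_less_one)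
qed

text \<open>The vertices with a walk of length exactly \<open>j\<close> onto the cycle form an
  increasing chain, because a walk can be prolonged along the cycle. The chain starts with
  \<open>s\<close> vertices, so \<open>n - s\<close> steps exhaust the rest.\<close>

lemma walk_onto_cycle:
  assumes c: "simple_cycle n N s c" and a: "a < n"
  shows "\<exists>i. bpow n N (n - s) a (c i)"
proof -
  define F where "F j = {a. a < n \<and> (\<exists>i. bpow n N j a (c i))}" for j
  define G where "G S = {a. a < n \<and> (\<exists>b\<in>S. N a b)}" for S
  note cD = simple_cycleD[OF c]
  have F_Suc: "F (Suc j) = G (F j)" for j
  proof -
    have "F (Suc j) = {a. a < n \<and> (\<exists>i. \<exists>l<n. N a l \<and> bpow n N j l (c i))}"
      using cD(2) by (simp add: F_def bpow_Suc_left del: bpow.simps cong: conj_cong)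
    then show ?thesis unfolding F_def G_def by blast
  qed
  have F_mono: "F j \<subseteq> F (Suc j)" for j
  proof
    fix a assume "a \<in> F j"
    then obtain i where "a < n" "bpow n N j a (c i)" by (auto simp: F_def)
    then have "bpow n N (Suc j) a (c (Suc i))" using cD by (auto simp: bmult_def)
    then show "a \<in> F (Suc j)" using \<open>a < n\<close> by (auto simp: F_def)
  qed
  have F0: "F 0 = range c" using cD(2) by (auto simp: F_def bident_def)
  obtain r where "\<forall>t\<ge>r. \<forall>i<n. \<forall>j<n. bpow n N t i j" using eventually_full by blast
  then have "F r = {..<n}" using cD(2) by (auto simp: F_def)
  then have "min (card {..<n}) (card (F 0) + (n - s)) \<le> card (F (n - s))"
    using F_Suc F_mono by (intro card_chain_ge[where G = G and J = r]) (auto simp: F_def)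
  then have "n \<le> card (F (n - s))"
    using F0 simple_cycle_range[OF c] by simp
  moreover have "F (n - s) \<subseteq> {..<n}" by (auto simp: F_def)
  ultimately have "F (n - s) = {..<n}" by (intro card_seteq) auto
  then show ?thesis using a by (auto simp: F_def)
qed

text \<open>Counted in blocks of \<open>s\<close> steps, the sets reached from \<open>x\<close>
  increase because of the lap at \<open>x\<close>, so each block adds a vertex until all are
  reached.\<close>

lemma reach_growth:
  assumes x: "x < n" and lap: "bpow n N s x x" and s: "0 < s"
  shows "min n (j + 1) \<le> card {z. z < n \<and> bpow n N (j * s) x z}"
proof -
  define F where "F j = {z. z < n \<and> bpow n N (j * s) x z}" for j
  define G where "G S = {z. z < n \<and> (\<exists>y\<in>S. bpow n N s y z)}" for S
  have F_Suc: "F (Suc j) = G (F j)" for j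
    using bpow_add[of _ n N "j * s" s x] by (auto simp: F_def G_def add.commute)
  have F_mono: "F j \<subseteq> F (Suc j)" for j
    using bpow_trans[OF lap _ x] by (auto simp: F_def)
  obtain r where "\<forall>t\<ge>r. \<forall>i<n. \<forall>j<n. bpow n N t i j" using eventually_full by blast
  moreover have "r \<le> r * s" using s by simp
  ultimately have "F r = {..<n}" using x by (auto simp: F_def)
  then have "min (card {..<n}) (card (F 0) + j) \<le> card (F j)"
    using F_Suc F_mono by (intro card_chain_ge[where G = G and J = r]) (auto simp: F_def)
  moreover have "F 0 = {x}" using x by (auto simp: F_def bident_def)
  ultimately show ?thesis by (simp add: F_def)
qed

text \<open>After \<open>n - s\<close> steps both walkers are on the cycle. A further
  \<open>n div 2\<close> blocks of \<open>s\<close> steps let each of them reach more than half of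
  the vertices, so the two reachable sets intersect.\<close>

lemma meets_via_cycle:
  assumes c: "simple_cycle n N s c" and ab: "a < n" "b < n"
  shows "meets n N (n - s + n div 2 * s) a b"
proof -
  note cD = simple_cycleD[OF c]
  define R where "R x = {z. z < n \<and> bpow n N (n div 2 * s) x z}" for x
  obtain i j where ij: "bpow n N (n - s) a (c i)" "bpow n N (n - s) b (c j)"
    using walk_onto_cycle[OF c] ab by blast
  have R: "min n (n div 2 + 1) \<le> card (R (c k))" for k
    unfolding R_def using reach_growth simple_cycle_closed[OF c] cD by blast
  have "n < card (R (c i)) + card (R (c j))" using R[of i] R[of j] ab by linarith
  moreover have "card (R (c i) \<union> R (c j)) \<le> card {..<n}"
    by (rule card_mono) (auto simp: R_def)
  moreover have fin: "finite (R x)" for x by (simp add: R_def)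
  ultimately have "R (c i) \<inter> R (c j) \<noteq> {}"
    using card_Un_disjoint[of "R (c i)" "R (c j)"] by fastforce
  then have "meets n N (n div 2 * s) (c i) (c j)" by (auto simp: R_def meets_def)
  then show ?thesis using meets_walks ij cD by blast
qed

text \<open>The cycle is a single vertex with a loop, at which both walkers arrive.\<close>

lemma meets_via_loop:
  assumes c: "simple_cycle n N 1 c" and ab: "a < n" "b < n"
  shows "meets n N (n - 1) a b"
proof -
  obtain i j where ij: "bpow n N (n - 1) a (c i)" "bpow n N (n - 1) b (c j)"
    using walk_onto_cycle[OF c] ab by blast
  moreover have "c i = c j" using simple_cycleD(4)[OF c] by simp
  ultimately show ?thesis using simple_cycleD(2)[OF c] by (auto simp: meets_def)
qed

text \<open>Laps of lengths \<open>s\<close> and \<open>s + 1\<close>, one per unit of distance, compensate the distance.\<close>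
lemma meets_via_laps:
  assumes "bpow n N d1 x z" "bpow n N d2 z y" "bpow n N s z z" "bpow n N (Suc s) y y"
    "x < n" "y < n" "z < n"
  shows "meets n N ((d1 + d2) * Suc s) x y"
proof -
  have "bpow n N ((d1 + d2) * s) z z" using assms bpow_laps by blast
  then have "bpow n N (d1 + (d1 + d2) * s + d2) x y"
    using bpow_trans assms by blast
  moreover have "bpow n N ((d1 + d2) * Suc s) y y" using bpow_laps[OF assms(4)] assms by blast
  moreover have "d1 + (d1 + d2) * s + d2 = (d1 + d2) * Suc s" by simp
  ultimately show ?thesis using assms(6) by (auto simp: meets_def simp del: mult_Suc_right)
qed

text \<open>The cycle \<open>c\<close> misses two vertices and \<open>e\<close> misses one, called
  \<open>v\<close>. Two vertices of \<open>e\<close> at distance \<open>d\<close> meet after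
  \<open>d * (n - 1)\<close> steps if the arc between them, ends included, has a vertex on
  \<open>c\<close>: there the laps of lengths \<open>n - 2\<close> and \<open>n - 1\<close> are
  combined. Adjacent vertices off \<open>c\<close>, and pairs containing \<open>v\<close>, are
  treated separately.\<close>

lemma meets_even_girth:
  assumes n: "n = 2 * h" "2 \<le> h"
    and c: "simple_cycle n N (n - 2) c" and e: "simple_cycle n N (n - 1) e"
    and girth: "\<And>m x. 0 < m \<Longrightarrow> x < n \<Longrightarrow> bpow n N m x x \<Longrightarrow> n - 2 \<le> m"
    and ab: "a < n" "b < n"
  shows "meets n N (wt n) a b"
proof -
  note cD = simple_cycleD[OF c] and eD = simple_cycleD[OF e]
  have "card ({..<n} - range c) = 2" "card ({..<n} - range e) = 1"
    using simple_cycle_range[OF c] simple_cycle_range[OF e] n by (auto simp: card_Diff_subset)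
  then obtain v where v: "{..<n} - range e = {v}" by (auto simp: card_1_singleton_iff)
  have out_c: "{..<n} - range c = {x, y}"
    if "x < n" "y < n" "x \<notin> range c" "y \<notin> range c" "x \<noteq> y" for x y
    using that \<open>card ({..<n} - range c) = 2\<close>
    by (intro card_seteq[symmetric]) auto
  obtain k where k: "h = 2 + k" using n(2) le_Suc_ex by blast
  \<comment> \<open>The bound leaves one step to spare, which is spent when a walker starts at
    \<open>v\<close>.\<close>
  have early: "d * (n - 1) \<le> wt n - 1" if "2 * d \<le> n - 1" for d
  proof -
    have "d * (n - 1) \<le> (k + 1) * (n - 1)" using that n k by (intro mult_right_mono) auto
    also have "\<dots> \<le> wt n - 1" unfolding n(1) wt_even k by (simp add: algebra_simps)
    finally show ?thesis .
  qed
  have "n \<le> wt n" unfolding n(1) wt_even k by (simp add: algebra_simps)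
  have n1: "n - 1 = Suc (n - 2)" using n by simp
  have e_closed: "bpow n N (Suc (n - 2)) (e i) (e i)" for i
    using simple_cycle_closed[OF e, of i] unfolding n1 .
  have c_closed: "bpow n N (n - 2) z z" if "z \<in> range c" for z
    using simple_cycle_closed[OF c] that by blast
  have on_c: "meets n N (wt n - 1) x y"
    if x: "x \<in> range e" and y: "y \<in> range e" and xy: "x \<in> range c \<or> y \<in> range c \<or> x = y" for x y
  proof (cases "x = y")
    case True
    then show ?thesis using meets_self x eD(2) by blast
  next
    case False
    have *: "meets n N (wt n - 1) (e i) (e (i + d))"
      if "2 * d \<le> n - 1" "e i \<in> range c \<or> e (i + d) \<in> range c" for i d
    proof -
      have "meets n N (d * Suc (n - 2)) (e i) (e (i + d))"
        using that(2)
      proof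
        assume "e i \<in> range c"
        then show ?thesis
          using meets_via_laps[of 0 "e i" "e i" d "e (i + d)" "n - 2"]
            simple_cycle_bpow[OF e] e_closed c_closed eD(2) by simp
      next
        assume "e (i + d) \<in> range c"
        then show ?thesis
          using meets_via_laps[of d "e i" "e (i + d)" 0 "e (i + d)" "n - 2"]
            simple_cycle_bpow[OF e] e_closed c_closed eD(2) by simp
      qed
      then show ?thesis using early[OF that(1)] meets_later unfolding n1 by blast
    qed
    obtain i d where "2 * d \<le> n - 1" "x = e i \<and> y = e (i + d) \<or> y = e i \<and> x = e (i + d)"
      using simple_cycle_distance[OF e x y False] by blast
    then show ?thesis using *[of d i] xy False meets_sym[of n N _ x y] by auto
  qed
  have off_c: "meets n N (wt n) x y"
    if x: "x \<in> range e" and y: "y \<in> range e" and xy: "x \<notin> range c" "y \<notin> range c" "x \<noteq> y" for x y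
  proof -
    have *: "meets n N (wt n) (e i) (e (i + d))"
      if d: "0 < d" "2 * d \<le> n - 1" and out: "e i \<notin> range c" "e (i + d) \<notin> range c" for i d
    proof -
      have ne: "e (i + d) \<noteq> e i" using d by (intro simple_cycle_neq[OF e]) auto
      have "{..<n} - range c = {e i, e (i + d)}"
        by (rule out_c) (use out ne eD(2) in auto)
      then have in_c: "z \<in> range c" if "z < n" "z \<noteq> e i" "z \<noteq> e (i + d)" for z
        using that by (metis DiffI insertE lessThan_iff singletonD)
      show ?thesis
      proof (cases "d = 1")
        case True
        \<comment> \<open>No vertex lies between the two. Both go on to the next vertex
          \<open>z\<close>, which is on both cycles, and laps of different lengths there balance the
          unit distance.\<close>
        define z where "z = e (i + 2)"
        have "z \<noteq> e i" "z \<noteq> e (i + 1)"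
          using simple_cycle_neq[OF e, of 2 i] simple_cycle_neq[OF e, of 1 "i + 1"] n
          by (auto simp: z_def)
        then have z: "z \<in> range c" "z < n" using in_c[of z] True eD(2) by (auto simp: z_def)
        have "bpow n N (2 + (n - 2)) (e i) z"
          using bpow_trans[OF simple_cycle_bpow[OF e, of 2 i]] c_closed z by (simp add: z_def)
        moreover have "bpow n N (1 + Suc (n - 2)) (e (i + 1)) z"
          using bpow_trans[OF simple_cycle_bpow[OF e, of 1 "i + 1"]] e_closed[of "i + 2"] z(2)
          by (simp add: z_def del: bpow.simps)
        moreover have "2 + (n - 2) = n" "1 + Suc (n - 2) = n" using n by auto
        ultimately have "meets n N n (e i) (e (i + d))"
          using True z(2) unfolding meets_def by metis
        then show ?thesis using \<open>n \<le> wt n\<close> by (rule meets_later)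
      next
        case False
        \<comment> \<open>Only the two ends of the arc are off \<open>c\<close>, so its second
          vertex lies on both cycles.\<close>
        have "d - 1 < n - 1" "0 < d - 1" using d False by linarith+
        then have "e (i + 1) \<noteq> e i" "e (i + 1) \<noteq> e (i + d)"
          using simple_cycle_neq[OF e, of 1 i] simple_cycle_neq[OF e, of "d - 1" "i + 1"] d False n
          by auto
        then have "e (i + 1) \<in> range c" using in_c eD(2) by blast
        then have "meets n N ((1 + (d - 1)) * Suc (n - 2)) (e i) (e (i + d))"
          using simple_cycle_bpow[OF e, of 1 i] simple_cycle_bpow[OF e, of "d - 1" "i + 1"]
            e_closed c_closed eD(2) d
          by (intro meets_via_laps[where z = "e (i + 1)"]) auto
        then have "meets n N (d * (n - 1)) (e i) (e (i + d))" using d n1 by simp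
        moreover have "d * (n - 1) \<le> wt n" using early[OF d(2)] by linarith
        ultimately show ?thesis by (rule meets_later)
      qed
    qed
    obtain i d where "0 < d" "2 * d \<le> n - 1" "x = e i \<and> y = e (i + d) \<or> y = e i \<and> x = e (i + d)"
      using simple_cycle_distance[OF e x y xy(3)] by blast
    then show ?thesis using *[of d i] xy meets_sym[of n N _ x y] by auto
  qed
  have wt_pos: "Suc (wt n - 1) = wt n" using \<open>n \<le> wt n\<close> n by linarith
  have from_v: "meets n N (wt n) v b" if "b < n" for b
  proof (cases "b = v")
    case True
    then show ?thesis using meets_self that by blast
  next
    case False
    have vn: "v < n" "v \<notin> range e" using v by auto
    have in_e: "z \<in> range e" if "z < n" "z \<noteq> v" for z using v that by blast
    obtain i where "b = e i" using in_e[of b] \<open>b < n\<close> False by blast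
    define b' where "b' = e (Suc i)"
    have b': "N b b'" "b' \<in> range e" "b' < n" using eD \<open>b = e i\<close> by (auto simp: b'_def)
    \<comment> \<open>One step leads to a pair covered by \<open>on_c\<close>. If \<open>v\<close>
      is off \<open>c\<close>, just one other vertex is, so \<open>a'\<close> and \<open>b'\<close>
      coincide when both are off \<open>c\<close>. The girth rules out a loop at
      \<open>v\<close>.\<close>
    obtain a' where a': "N v a'" "a' < n" "a' \<noteq> v" "a' \<in> range c \<or> b' \<in> range c \<or> a' = b'"
    proof (cases "v \<in> range c")
      case True
      then obtain j where j: "v = c j" by blast
      have "c (Suc j) \<noteq> v"
      proof
        assume eq: "c (Suc j) = v"
        have "N v v" using cD(3)[of j] eq j by simp
        then have "n - 2 \<le> Suc 0" using girth[of "Suc 0" v] bpow_1[of v n N v] vn by blast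
        then show False using n by simp
      qed
      then show ?thesis using that[of "c (Suc j)"] cD j by auto
    next
      case out: False
      obtain a' where a': "a' < n" "N v a'" using row_nonzero vn by blast
      have "a' \<noteq> v"
      proof
        assume "a' = v"
        then have "n - 2 \<le> Suc 0" using girth[of "Suc 0" v] bpow_1[of v n N v] vn a' by blast
        then show False using n by simp
      qed
      moreover have "a' = b'" if "a' \<notin> range c" "b' \<notin> range c"
      proof -
        have "{..<n} - range c = {v, a'}"
          by (rule out_c) (use out that a' vn \<open>a' \<noteq> v\<close> in auto)
        then have "b' \<in> {v, a'}" using that b' by auto
        moreover have "b' \<noteq> v" using b' vn by auto
        ultimately show ?thesis by simp
      qed
      ultimately show ?thesis using that a' by blast
    qed
    have "meets n N (wt n - 1) a' b'" using on_c[of a' b'] in_e[of a'] a' b' by blast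
    then have "meets n N (Suc (wt n - 1)) v b" using meets_step a' b' vn that by blast
    then show ?thesis unfolding wt_pos .
  qed
  show ?thesis
  proof (cases "a = v \<or> b = v")
    case True
    then show ?thesis using from_v ab meets_sym by blast
  next
    case False
    then have "a \<in> range e" "b \<in> range e" using v ab by blast+
    then show ?thesis using on_c[of a b] off_c[of a b] meets_later[of "wt n - 1" a b "wt n"] by force
  qed
qed

section \<open>Hamiltonian cycles with a chord\<close>

lemma W_embeds:
  assumes c: "simple_cycle n N n c" and chord: "N (c (n - 2)) (c 0)"
    and ij: "W n i j" "i < n" "j < n"
  shows "N (c i) (c j)"
proof -
  have "c (Suc (n - 1)) = c 0" using simple_cycleD(4)[OF c] ij by simp
  then have "N (c (n - 1)) (c 0)" using simple_cycleD(3)[OF c, of "n - 1"] by simp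
  then show ?thesis using ij chord simple_cycleD(3)[OF c] by (auto simp: W_def)
qed

text \<open>The cycle with its chord maps \<open>W n\<close> into \<open>N\<close>, and further
  edges of \<open>N\<close> can only help walkers to meet. So only the image of the exceptional pair
  of \<open>W n\<close> remains.\<close>

lemma not_meets_pair:
  assumes n: "3 \<le> n" and c: "simple_cycle n N n c" and chord: "N (c (n - 2)) (c 0)"
    and ab: "a < n" "b < n" "\<not> meets n N (wt n) a b"
  shows "{a, b} = {c (n div 2 - 1), c (n - 1)}"
proof -
  have "range c = {..<n}" using simple_cycle_range[OF c] by (intro card_seteq) auto
  then have "a \<in> c ` {..<n}" "b \<in> c ` {..<n}" using simple_cycle_range(1)[OF c] ab by auto
  then obtain i j where ij: "a = c i" "i < n" "b = c j" "j < n" by auto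
  have "\<not> meets n (W n) (wt n) i j"
  proof
    assume "meets n (W n) (wt n) i j"
    then obtain l where l: "l < n" "bpow n (W n) (wt n) i l" "bpow n (W n) (wt n) j l"
      by (auto simp: meets_def)
    have "bpow n N (wt n) (c k) (c l)" if "k < n" "bpow n (W n) (wt n) k l" for k
      using bpow_hom[of n "W n" N c n] W_embeds[OF c chord] simple_cycleD(2)[OF c] that l(1) by blast
    then have "meets n N (wt n) a b" using l ij simple_cycleD(2)[OF c] unfolding meets_def by blast
    then show False using ab by blast
  qed
  then have "{i, j} = {n div 2 - 1, n - 1}" using W_meets_wt[OF n] ij by blast
  then have "c ` {i, j} = c ` {n div 2 - 1, n - 1}" by simp
  then show ?thesis using ij by simp
qed

text \<open>By the girth, an edge advances by at most two along the Hamiltonian cycle, so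
  \<open>e\<close> passes its missing vertex on a chord. A second chord would yield a copy of
  \<open>W n\<close> with a different exceptional pair, or a closed walk that is too short.\<close>

lemma W_of_large_girth:
  assumes n: "3 \<le> n" and c0: "simple_cycle n N n c0" and e: "simple_cycle n N (n - 1) e"
    and girth: "\<And>m x. 0 < m \<Longrightarrow> x < n \<Longrightarrow> bpow n N m x x \<Longrightarrow> n - 1 \<le> m"
    and ab: "a < n" "b < n" "\<not> meets n N (wt n) a b"
  shows "\<exists>\<sigma>. bij_betw \<sigma> {..<n} {..<n} \<and> (\<forall>i<n. \<forall>j<n. N (\<sigma> i) (\<sigma> j) = W n i j)"
proof -
  have "card ({..<n} - range e) = 1"
    using simple_cycle_range[OF e] n by (auto simp: card_Diff_subset)
  then obtain w where w: "{..<n} - range e = {w}" by (auto simp: card_1_singleton_iff)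
  have surj: "range c = {..<n}" if "simple_cycle n N n c" for c
    using simple_cycle_range[OF that] by (intro card_seteq) auto
  have "w \<in> range c0" using surj[OF c0] w by blast
  then obtain k where k: "w = c0 k" by blast
  \<comment> \<open>This rotation puts the vertex missed by \<open>e\<close> at position
    \<open>n - 1\<close>.\<close>
  define c where "c i = c0 (i + Suc k)" for i
  have c: "simple_cycle n N n c" unfolding c_def by (rule simple_cycle_shift[OF c0])
  note cD = simple_cycleD[OF c]
  have cw: "c (n - 1) = w" using simple_cycle_period[OF c0, of k] k n by (simp add: c_def add.commute)
  have edge: "y = c (i + 1) \<or> y = c (i + 2)" if "N (c i) y" "y < n" for i y
  proof -
    have shift: "simple_cycle n N n (\<lambda>t. c (t + Suc i))" by (rule simple_cycle_shift[OF c])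
    have "y \<in> (\<lambda>t. c (t + Suc i)) ` {..<n}"
      unfolding simple_cycle_range(1)[OF shift, symmetric] surj[OF shift] using that by simp
    then obtain t where t: "t < n" "y = c (t + Suc i)" by auto
    define d where "d = Suc t"
    have d: "1 \<le> d" "d \<le> n" using t by (auto simp: d_def)
    have "y = c (i + d)" using t by (simp add: d_def add.commute)
    moreover have "d \<le> 2"
    proof -
      \<comment> \<open>An edge advancing by \<open>d\<close> closes up with the remaining
        \<open>n - d\<close> steps of the cycle, and the girth bounds the total length from
        below.\<close>
      have "bpow n N (Suc 0) (c i) y" using that cD(2) bpow_1 by blast
      moreover have "bpow n N (n - d) y (c i)"
        using simple_cycle_bpow[OF c, of "n - d" "i + d"] \<open>y = c (i + d)\<close> d
          simple_cycle_period[OF c, of i] by simp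
      ultimately have "bpow n N (Suc 0 + (n - d)) (c i) (c i)" using bpow_trans that cD(2) by blast
      then have "n - 1 \<le> Suc 0 + (n - d)" using girth[of "Suc 0 + (n - d)" "c i"] cD(2) by simp
      then show ?thesis using d by linarith
    qed
    ultimately show ?thesis using d by (metis One_nat_def Suc_1 le_Suc_eq le_antisym)
  qed
  have chord: "N (c (n - 2)) (c 0)"
  proof -
    have "c (n - 2 + 1) \<noteq> c (n - 2)" using n by (intro simple_cycle_neq[OF c]) auto
    moreover have "n - 2 + 1 = n - 1" using n by simp
    ultimately have "c (n - 2) \<noteq> w" using cw by metis
    then obtain t where t: "c (n - 2) = e t" using w cD(2) by blast
    have "N (c (n - 2)) (e (Suc t))" using simple_cycleD(3)[OF e, of t] t by simp
    moreover have "e (Suc t) \<noteq> c (n - 2 + 1)" using cw w \<open>n - 2 + 1 = n - 1\<close> by (metis DiffE insertI1 rangeI)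
    ultimately have "e (Suc t) = c (n - 2 + 2)" using edge simple_cycleD(2)[OF e] by blast
    also have "\<dots> = c 0"
    proof -
      have "n - 2 + 2 = 0 + n" using n by simp
      then show ?thesis using simple_cycle_period[OF c, of 0] by (simp only:)
    qed
    finally show ?thesis using \<open>N (c (n - 2)) (e (Suc t))\<close> by simp
  qed
  have "N (c i) (c j) = W n i j" if ij: "i < n" "j < n" for i j
  proof (rule ccontr)
    assume "N (c i) (c j) \<noteq> W n i j"
    then have ne: "N (c i) (c j)" "\<not> W n i j" using W_embeds[OF c chord] ij by blast+
    have "c j \<noteq> c (i + 1)"
    proof
      assume "c j = c (i + 1)"
      then have "j = (i + 1) mod n" using cD(4) ij by simp
      then show False using ne(2) ij n by (cases "i + 1 = n") (auto simp: W_def)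
    qed
    then have j: "c j = c (i + 2)" using edge ne(1) cD(2) by blast
    have i2: "i + 2 \<noteq> n"
    proof
      assume "i + 2 = n"
      then have "j = 0" using j cD(4) ij by simp
      then show False using ne(2) \<open>i + 2 = n\<close> by (auto simp: W_def)
    qed
    \<comment> \<open>Rotating the second chord into the place of the first gives another copy of
      \<open>W n\<close>, whose exceptional pair must also be \<open>{a, b}\<close>.\<close>
    define c' where "c' t = c (t + (i + 2))" for t
    have c': "simple_cycle n N n c'" unfolding c'_def by (rule simple_cycle_shift[OF c])
    have "n - 2 + (i + 2) = i + n" using n by simp
    then have "c' (n - 2) = c i" using simple_cycle_period[OF c, of i] by (simp only: c'_def)
    moreover have "c' 0 = c j" using j by (simp add: c'_def)
    ultimately have "N (c' (n - 2)) (c' 0)" using ne(1) by simp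
    then have "{c (n div 2 - 1), c (n - 1)} = {c' (n div 2 - 1), c' (n - 1)}"
      using not_meets_pair[OF n c chord ab] not_meets_pair[OF n c' _ ab] by simp
    moreover have "c (n div 2 - 1) \<noteq> c' (n div 2 - 1)"
    proof (cases "i + 2 < n")
      case True
      then show ?thesis unfolding c'_def using simple_cycle_neq[OF c, of "i + 2" "n div 2 - 1"] by simp
    next
      case False
      then have "i + 2 = n + 1" using ij i2 by linarith
      then have "c' (n div 2 - 1) = c (n div 2 - 1 + 1)"
        unfolding c'_def using simple_cycle_period[OF c, of "n div 2 - 1 + 1"] by (simp add: algebra_simps)
      then show ?thesis using simple_cycle_neq[OF c, of 1 "n div 2 - 1"] n by simp
    qed
    \<comment> \<open>The two pairs can agree only crosswise, which will force \<open>n\<close> to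
      be even and the chords to lie opposite each other.\<close>
    ultimately have eq: "c (n div 2 - 1) = c' (n - 1)" "c (n - 1) = c' (n div 2 - 1)"
      by (auto simp: doubleton_eq_iff)
    have 1: "n div 2 - 1 = (i + 1) mod n"
    proof -
      have "n - 1 + (i + 2) = i + 1 + n" using n by simp
      then have "c' (n - 1) = c (i + 1)"
        using simple_cycle_period[OF c, of "i + 1"] by (simp only: c'_def)
      then show ?thesis using eq(1) cD(4)[of "n div 2 - 1" "i + 1"] n by simp
    qed
    have 2: "n - 1 = (n div 2 - 1 + (i + 2)) mod n"
      using eq(2) cD(4)[of "n - 1" "n div 2 - 1 + (i + 2)"] n by (simp add: c'_def)
    have "i + 1 \<noteq> n"
    proof
      assume "i + 1 = n"
      then have "n div 2 - 1 = 0" using 1 by simp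
      then have "n = 3" using n by linarith
      then show False using 2 \<open>i + 1 = n\<close> by simp
    qed
    then have i: "i + 2 = n div 2" using 1 ij n by simp
    have "n - 1 = (n div 2 - 1 + n div 2) mod n" using 2 unfolding i .
    moreover have "n div 2 - 1 + n div 2 < n" using n by linarith
    ultimately have "n - 1 = n div 2 - 1 + n div 2" using mod_less by metis
    then have n2: "n = 2 * (i + 2)" using n unfolding i[symmetric] by presburger
    \<comment> \<open>Taking both chords closes a walk of length \<open>n - 2\<close>, against the
      girth.\<close>
    have "bpow n N i (c 0) (c i)" using simple_cycle_bpow[OF c, of i 0] by simp
    moreover have "bpow n N (Suc 0) (c i) (c (i + 2))"
      unfolding bpow_1[OF cD(2)] using ne(1) j by simp
    moreover have "bpow n N i (c (i + 2)) (c (n - 2))"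
      using simple_cycle_bpow[OF c, of i "i + 2"] n2 by (simp add: add.commute mult_2)
    moreover have "bpow n N (Suc 0) (c (n - 2)) (c 0)"
      unfolding bpow_1[OF cD(2)] by (rule chord)
    ultimately have "bpow n N (i + Suc 0 + i + Suc 0) (c 0) (c 0)"
      using bpow_trans cD(2) by blast
    then have "n - 1 \<le> i + Suc 0 + i + Suc 0" using girth[of "i + Suc 0 + i + Suc 0" "c 0"] cD(2) by simp
    then show False using n2 by simp
  qed
  moreover have "bij_betw c {..<n} {..<n}"
    using surj[OF c] simple_cycle_range(1)[OF c] cD(4) by (auto simp: bij_betw_def inj_on_def)
  ultimately show ?thesis by blast
qed

text \<open>The cases are the lengths \<open>s\<close> of a shortest cycle. The copy of
  \<open>W n\<close> arises for \<open>s = n - 1\<close>; \<open>s = n\<close> contradicts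
  primitivity, and every smaller \<open>s\<close> lets all pairs meet by time
  \<open>wt n\<close>.\<close>

theorem not_meets_imp_W:
  assumes n: "3 \<le> n" and ab: "a < n" "b < n" "\<not> meets n N (wt n) a b"
  shows "\<exists>\<sigma>. bij_betw \<sigma> {..<n} {..<n} \<and> (\<forall>i<n. \<forall>j<n. N (\<sigma> i) (\<sigma> j) = W n i j)"
proof -
  obtain s c where c: "simple_cycle n N s c"
    and girth: "\<And>m x. 0 < m \<Longrightarrow> x < n \<Longrightarrow> bpow n N m x x \<Longrightarrow> s \<le> m"
    using shortest_cycle n by auto
  have s: "0 < s" "s \<le> n" using simple_cycleD(1)[OF c] simple_cycle_range(4)[OF c] by auto
  have cyc: "\<exists>m e. \<not> p dvd m \<and> simple_cycle n N m e \<and> s \<le> m \<and> m \<le> n" if p: "2 \<le> p" for p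
  proof -
    obtain m e where me: "\<not> p dvd m" "simple_cycle n N m e"
      using nondivisible_cycle[OF _ p] n by (auto simp del: One_nat_def)
    have "s \<le> m" using girth[of m "e 0"] simple_cycle_closed[OF me(2)] simple_cycleD[OF me(2)] by blast
    then show ?thesis using me simple_cycle_range(4)[OF me(2)] by blast
  qed
  have late: "wt n < t" if "meets n N t a b" for t
    using that ab(3) meets_later not_le by blast
  obtain h where h: "n = 2 * h \<or> n = 2 * h + 1" by (meson oddE evenE)
  \<comment> \<open>For even \<open>n\<close> and \<open>s = n - 2\<close> the general bound
    \<open>n - s + n div 2 * s\<close> exceeds \<open>wt n\<close> by two, so this case is split
    off.\<close>
  have "s = 1 \<or> s = n \<or> s = n - 1 \<and> 2 \<le> s \<or> even n \<and> s = n - 2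
    \<or> n = 2 * h + 1 \<and> 2 \<le> s \<and> s \<le> n - 2 \<or> n = 2 * h \<and> 2 \<le> s \<and> s \<le> n - 3"
    using s h by presburger
  then consider "s = 1" | "s = n" | "s = n - 1" "2 \<le> s" | "even n" "s = n - 2"
    | "n = 2 * h + 1" "2 \<le> s" "s \<le> n - 2" | "n = 2 * h" "2 \<le> s" "s \<le> n - 3"
    by blast
  then show ?thesis
  proof cases
    case 1
    then have "wt n < n - 1" using late meets_via_loop c ab by blast
    moreover have "n - 1 \<le> wt n"
      using h
    proof
      assume h: "n = 2 * h"
      then obtain k where "h = 2 + k" using n le_Suc_ex[of 2 h] by auto
      then show ?thesis unfolding h wt_even by (simp add: algebra_simps)
    next
      assume h: "n = 2 * h + 1"
      then show ?thesis unfolding h wt_odd by simp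
    qed
    ultimately show ?thesis by simp
  next
    case 2
    then show ?thesis using cyc[of n] n by force
  next
    case 3
    \<comment> \<open>A cycle whose length is not a multiple of \<open>s = n - 1\<close> must be
      Hamiltonian.\<close>
    obtain m e where me: "\<not> s dvd m" "simple_cycle n N m e" "s \<le> m" "m \<le> n"
      using cyc[OF 3(2)] by blast
    then have "m \<noteq> s" by auto
    then have "m = n" using me 3 by linarith
    then show ?thesis using W_of_large_girth[OF n _ _ _ ab] me(2) c girth 3(1) by blast
  next
    case 4
    \<comment> \<open>An odd length between \<open>n - 2\<close> and \<open>n\<close> can only be
      \<open>n - 1\<close>.\<close>
    obtain m e where me: "\<not> 2 dvd m" "simple_cycle n N m e" "s \<le> m" "m \<le> n"
      using cyc[of 2] n by auto
    then have "m = n - 1" using 4 n by presburger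
    moreover obtain k where "n = 2 * k" using 4(1) by blast
    ultimately show ?thesis using meets_even_girth[of k c e a b] me(2) c girth 4(2) ab n by auto
  next
    case 5
    then have "2 \<le> h" by linarith
    then obtain k where k: "h = 2 + k" using le_Suc_ex by blast
    have "n - s + n div 2 * s \<le> wt n"
    proof -
      have "n div 2 = h" "h * s = (h - 1) * s + s" using 5 k by (auto simp: algebra_simps)
      then have "n - s + n div 2 * s = n + (h - 1) * s" using s by simp
      also have "\<dots> \<le> n + (h - 1) * (n - 2)" using 5 by (intro add_left_mono mult_left_mono) auto
      also have "\<dots> \<le> wt n" unfolding 5(1) wt_odd k by (simp add: algebra_simps)
      finally show ?thesis .
    qed
    then show ?thesis using late[OF meets_via_cycle[OF c ab(1,2)]] by simp
  next
    case 6
    then have "3 \<le> h" by linarith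
    then obtain k where k: "h = 3 + k" using le_Suc_ex by blast
    have "n - s + n div 2 * s \<le> wt n"
    proof -
      have "n div 2 = h" "h * s = (h - 1) * s + s" using 6 k by (auto simp: algebra_simps)
      then have "n - s + n div 2 * s = n + (h - 1) * s" using s by simp
      also have "\<dots> \<le> n + (h - 1) * (n - 3)" using 6 by (intro add_left_mono mult_left_mono) auto
      also have "\<dots> \<le> wt n" unfolding 6(1) wt_even k by (simp add: algebra_simps)
      finally show ?thesis .
    qed
    then show ?thesis using late[OF meets_via_cycle[OF c ab(1,2)]] by simp
  qed
qed

end

section \<open>Boolean rank factorizations\<close>

lemma bpow_bmult_Suc:
  assumes "i < n" "j < n"
  shows "bpow n (bmult A b B) (Suc k) i j \<longleftrightarrow>
    (\<exists>p<b. \<exists>q<b. A i p \<and> bpow b (bmult B n A) k p q \<and> B q j)"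
  using assms(2)
proof (induction k arbitrary: j)
  case 0
  have "bpow n (bmult A b B) (Suc 0) i j \<longleftrightarrow> (\<exists>p<b. A i p \<and> B p j)"
    using assms(1) by (simp add: bpow_1 bmult_def[of A] del: bpow.simps)
  then show ?case by (auto simp: bident_def)
next
  case (Suc k)
  have "bpow n (bmult A b B) (Suc (Suc k)) i j \<longleftrightarrow>
      (\<exists>l<n. bpow n (bmult A b B) (Suc k) i l \<and> bmult A b B l j)"
    by (subst bpow.simps(2)) (simp only: bmult_def)
  also have "\<dots> \<longleftrightarrow> (\<exists>l<n. (\<exists>p<b. \<exists>q<b. A i p \<and> bpow b (bmult B n A) k p q \<and> B q l)
      \<and> (\<exists>r<b. A l r \<and> B r j))"
    using Suc.IH unfolding bmult_def[of A b B] by blast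
  also have "\<dots> \<longleftrightarrow> (\<exists>p<b. \<exists>r<b. A i p \<and>
      (\<exists>q<b. bpow b (bmult B n A) k p q \<and> (\<exists>l<n. B q l \<and> A l r)) \<and> B r j)"
    by blast
  also have "\<dots> \<longleftrightarrow> (\<exists>p<b. \<exists>r<b. A i p \<and> bpow b (bmult B n A) (Suc k) p r \<and> B r j)"
    by (simp add: bmult_def)
  finally show ?case .
qed

text \<open>The inner index \<open>p\<close> contributes nothing, so the last index can take its
  place.\<close>

lemma bfactorization_drop:
  assumes f: "bfactorization n M b A B" and p: "p < b"
    and z: "\<And>i j. i < n \<Longrightarrow> j < n \<Longrightarrow> \<not> (A i p \<and> B p j)"
  shows "\<exists>A B. bfactorization n M (b - 1) A B"
proof -
  define g where "g l = (if l = p then b - 1 else l)" for l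
  have "M i j = bmult (\<lambda>i l. A i (g l)) (b - 1) (\<lambda>l j. B (g l) j) i j" if ij: "i < n" "j < n" for i j
  proof -
    have "(\<exists>l<b. A i l \<and> B l j) \<longleftrightarrow> (\<exists>l<b - 1. A i (g l) \<and> B (g l) j)"
    proof
      assume "\<exists>l<b. A i l \<and> B l j"
      then obtain l where l: "l < b" "A i l" "B l j" by blast
      then have "l \<noteq> p" using z ij by blast
      show "\<exists>l<b - 1. A i (g l) \<and> B (g l) j"
      proof (cases "l = b - 1")
        case True
        then have "p < b - 1" using \<open>l \<noteq> p\<close> p by linarith
        moreover have "g p = l" using True by (simp add: g_def)
        ultimately show ?thesis using l by blast
      next
        case False
        then have "l < b - 1" "g l = l" using l \<open>l \<noteq> p\<close> by (auto simp: g_def)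
        then show ?thesis using l by auto
      qed
    next
      assume "\<exists>l<b - 1. A i (g l) \<and> B (g l) j"
      then obtain l where "l < b - 1" "A i (g l)" "B (g l) j" by blast
      moreover have "g l < b" using \<open>l < b - 1\<close> by (auto simp: g_def)
      ultimately show "\<exists>l<b. A i l \<and> B l j" by blast
    qed
    then show ?thesis using f ij by (simp add: bfactorization_def bmult_def)
  qed
  then show ?thesis by (auto simp: bfactorization_def)
qed

lemma boolean_rank_factorization: "\<exists>A B. bfactorization n M (boolean_rank n M) A B"
proof -
  have "bfactorization n M n M bident"
    by (auto simp: bfactorization_def bmult_def bident_def)
  then have "\<exists>b A B. bfactorization n M b A B" by blast
  then show ?thesis unfolding boolean_rank_def by (rule LeastI_ex)
qed

lemma boolean_rank_le: "bfactorization n M b A B \<Longrightarrow> boolean_rank n M \<le> b"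
  unfolding boolean_rank_def by (rule Least_le) blast

text \<open>An inner index with an empty column in \<open>A\<close> or an empty row in
  \<open>B\<close> could be dropped, against the minimality of the rank.\<close>

lemma rank_factorization_nonzero:
  assumes f: "bfactorization n M (boolean_rank n M) A B" and p: "p < boolean_rank n M"
  shows "\<exists>i<n. A i p" "\<exists>j<n. B p j"
proof -
  have "\<exists>i<n. \<exists>j<n. A i p \<and> B p j"
  proof (rule ccontr)
    assume "\<not> ?thesis"
    then obtain A' B' where "bfactorization n M (boolean_rank n M - 1) A' B'"
      using bfactorization_drop[OF f p] by blast
    then have "boolean_rank n M \<le> boolean_rank n M - 1" by (rule boolean_rank_le)
    then show False using p by linarith
  qed
  then show "\<exists>i<n. A i p" "\<exists>j<n. B p j" by blast+
qed

section \<open>Rank factorizations of a primitive matrix\<close>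

locale rank_factorization = primitive_matrix n M for n :: nat and M :: bmat +
  fixes A B :: bmat
  assumes fact: "bfactorization n M (boolean_rank n M) A B"
begin

abbreviation "b \<equiv> boolean_rank n M"
abbreviation "N \<equiv> bmult B n A"

lemma bpow_Suc_iff:
  assumes "i < n" "j < n"
  shows "bpow n M (Suc k) i j \<longleftrightarrow> (\<exists>p<b. \<exists>q<b. A i p \<and> bpow b N k p q \<and> B q j)"
proof -
  have "bpow n M (Suc k) i j = bpow n (bmult A b B) (Suc k) i j"
    using fact assms by (intro bpow_cong) (auto simp: bfactorization_def)
  then show ?thesis using assms by (simp add: bpow_bmult_Suc del: bpow.simps)
qed

lemma A_row_nonzero: "i < n \<Longrightarrow> \<exists>p<b. A i p"
  using row_nonzero[of i] fact by (auto simp: bfactorization_def bmult_def)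

lemma A_col_nonzero: "p < b \<Longrightarrow> \<exists>i<n. A i p"
  and B_row_nonzero: "p < b \<Longrightarrow> \<exists>j<n. B p j"
  using rank_factorization_nonzero[OF fact] by blast+

text \<open>With the factors exchanged, \<open>N^(r+1) = B M^r A\<close>. If \<open>M^r\<close> is
  full, so is this product, because rows of \<open>B\<close> and columns of \<open>A\<close> are
  nonzero.\<close>

lemma primitive_N: "primitive b N"
proof -
  obtain r where r: "\<forall>t\<ge>r. \<forall>i<n. \<forall>j<n. bpow n M t i j" using eventually_full by blast
  have "bpow b N (Suc r) p q" if pq: "p < b" "q < b" for p q
  proof -
    obtain i j where ij: "i < n" "B p i" "j < n" "A j q"
      using A_col_nonzero B_row_nonzero pq by blast
    have "bpow n (bmult A b B) r i j = bpow n M r i j"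
      using fact ij by (intro bpow_cong) (auto simp: bfactorization_def)
    then have "bpow n (bmult A b B) r i j" using r ij by simp
    then show ?thesis
      using ij pq unfolding bpow_bmult_Suc[OF pq] by blast
  qed
  then show ?thesis unfolding primitive_def by (intro exI[of _ "Suc r"]) auto
qed

text \<open>A common endpoint \<open>l\<close> in \<open>N\<close> becomes a common column in
  \<open>M\<close> through any one in row \<open>l\<close> of \<open>B\<close>.\<close>

lemma meets_lift:
  assumes "meets b N k p q" "i < n" "j < n" "p < b" "q < b" "A i p" "A j q"
  shows "meets n M (Suc k) i j"
proof -
  obtain l where l: "l < b" "bpow b N k p l" "bpow b N k q l" using assms(1) by (auto simp: meets_def)
  obtain c where "c < n" "B l c" using B_row_nonzero l(1) by blast
  then have "bpow n M (Suc k) i c" "bpow n M (Suc k) j c"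
    using l assms bpow_Suc_iff by blast+
  then show ?thesis using \<open>c < n\<close> unfolding meets_def by blast
qed

text \<open>Permuting the inner index keeps the product and permutes rows and columns of
  \<open>N\<close> alike; this turns a relabelled \<open>W b\<close> into \<open>W b\<close>
  itself.\<close>

lemma relabel:
  assumes "bij_betw \<sigma> {..<b} {..<b}"
  shows "rank_factorization n M (\<lambda>i p. A i (\<sigma> p)) (\<lambda>p. B (\<sigma> p))"
proof unfold_locales
  have "bmult (\<lambda>i p. A i (\<sigma> p)) b (\<lambda>p. B (\<sigma> p)) i j \<longleftrightarrow> (\<exists>p\<in>\<sigma> ` {..<b}. A i p \<and> B p j)" for i j
    by (auto simp: bmult_def)
  then have "bmult (\<lambda>i p. A i (\<sigma> p)) b (\<lambda>p. B (\<sigma> p)) i j = bmult A b B i j" for i j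
    unfolding bij_betw_imp_surj_on[OF assms] by (auto simp: bmult_def)
  then show "bfactorization n M b (\<lambda>i p. A i (\<sigma> p)) (\<lambda>p. B (\<sigma> p))"
    using fact by (simp add: bfactorization_def)
qed

end

text \<open>A vertex \<open>l\<close> other than \<open>0\<close> has at most the predecessor
  \<open>l - 1\<close>.\<close>

lemma W_common_successor:
  assumes "W n u l" "W n v l" "u \<noteq> v" "u < n" "v < n"
  shows "l = 0 \<and> {u, v} = {n - 2, n - 1}"
proof -
  have "l = u + 1 \<or> l = 0 \<and> (u = n - 2 \<or> u = n - 1)" "l = v + 1 \<or> l = 0 \<and> (v = n - 2 \<or> v = n - 1)"
    using assms(1,2) unfolding W_def by fast+
  then show ?thesis using assms(3) by auto
qed

section \<open>Factorizations whose reversed product is the Wielandt matrix\<close>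

locale W_factorization = rank_factorization +
  assumes rank_ge: "3 \<le> boolean_rank n M"
    and BA: "bmat_eq (boolean_rank n M) (boolean_rank n M) (bmult B n A) (W (boolean_rank n M))"
begin

lemma N_eq_W: "p < b \<Longrightarrow> q < b \<Longrightarrow> N p q = W b p q"
  using BA by (simp add: bmat_eq_def)

lemma meets_N_iff: "p < b \<Longrightarrow> q < b \<Longrightarrow> meets b N t p q \<longleftrightarrow> meets b (W b) t p q"
  unfolding meets_def by (simp add: bpow_cong[OF N_eq_W] cong: conj_cong)

lemma meets_Suc_Suc_wt:
  assumes "i < n" "j < n"
  shows "meets n M (Suc (Suc (wt b))) i j"
proof -
  obtain p q where "p < b" "A i p" "q < b" "A j q" using A_row_nonzero assms by blast
  then show ?thesis
    using meets_lift[of "Suc (wt b)" p q i j] meets_N_iff W_meets_Suc_wt[OF rank_ge] assms by blast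
qed

text \<open>Row \<open>c\<close> of \<open>A\<close> has a one, at \<open>w\<close> say, so every
  one in column \<open>c\<close> of \<open>B\<close> marks a predecessor of \<open>w\<close> in
  \<open>W b\<close>. Two of them force \<open>w = 0\<close>.\<close>

lemma B_column_support:
  assumes "c < n" "B u c" "B v c" "u \<noteq> v" "u < b" "v < b" "i < b"
  shows "B i c \<longleftrightarrow> i = b - 2 \<or> i = b - 1"
proof -
  obtain w where w: "w < b" "A c w" using A_row_nonzero assms(1) by blast
  have W_w: "W b x w" if "x < b" "B x c" for x
    using N_eq_W[of x w] that w assms(1) by (auto simp: bmult_def)
  have uv: "w = 0" "{u, v} = {b - 2, b - 1}"
    using W_common_successor[of b u w v] W_w assms by auto
  show ?thesis
  proof
    assume "B i c"
    then show "i = b - 2 \<or> i = b - 1" using W_w[of i] uv(1) assms(7) by (auto simp: W_def)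
  next
    assume "i = b - 2 \<or> i = b - 1"
    then have "i = u \<or> i = v" using uv(2) by blast
    then show "B i c" using assms by blast
  qed
qed

text \<open>Rows of \<open>A\<close> give the starting vertices of walks in \<open>W b\<close>, and
  columns of \<open>B\<close> join their ends. Two rows fail to meet exactly when they start only at
  the exceptional pair and no column joins ends that are still distinct.\<close>

lemma not_meets_Suc_wt_iff:
  "(\<exists>i<n. \<exists>j<n. \<not> meets n M (Suc (wt b)) i j) \<longleftrightarrow>
    (\<exists>r<n. \<forall>j<b. A r j = (j = b div 2 - 1)) \<and> (\<exists>r<n. \<forall>j<b. A r j = (j = b - 1))
    \<and> \<not> (\<exists>c<n. \<forall>i<b. B i c = (i = b - 2 \<or> i = b - 1))" (is "?L \<longleftrightarrow> ?R")
proof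
  assume ?L
  then obtain i j where ij: "i < n" "j < n" "\<not> meets n M (Suc (wt b)) i j" by blast
  have pair: "{p, q} = {b div 2 - 1, b - 1}" if "p < b" "A i p" "q < b" "A j q" for p q
    using meets_lift[of "wt b" p q i j] meets_N_iff W_meets_wt[OF rank_ge] ij that by blast
  obtain p q where pq: "p < b" "A i p" "q < b" "A j q" using A_row_nonzero ij by blast
  \<comment> \<open>Replacing \<open>p\<close> by another one of row \<open>i\<close> must give the
    same pair, so row \<open>i\<close> is a unit vector; likewise row \<open>j\<close>.\<close>
  have single: "(\<forall>x<b. A i x = (x = p)) \<and> (\<forall>x<b. A j x = (x = q))"
    using pair pq by (metis doubleton_eq_iff)
  have rows: "(\<exists>r<n. \<forall>j<b. A r j = (j = b div 2 - 1)) \<and> (\<exists>r<n. \<forall>j<b. A r j = (j = b - 1))"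
    using single pair[OF pq] ij by (metis doubleton_eq_iff)
  moreover have False if c: "c < n" "\<forall>i<b. B i c = (i = b - 2 \<or> i = b - 1)" for c
  proof -
    \<comment> \<open>One step later the walkers meet in \<open>W b\<close>, coming from distinct
      vertices, hence from \<open>b - 2\<close> and \<open>b - 1\<close>. A column with ones at both
      would join them one step too early.\<close>
    obtain l where l: "l < b" "bpow b N (Suc (wt b)) p l" "bpow b N (Suc (wt b)) q l"
      using W_meets_Suc_wt[OF rank_ge pq(1,3)] meets_N_iff[OF pq(1,3)]
      by (auto simp: meets_def simp del: bpow.simps)
    then obtain u v where uv: "u < b" "bpow b N (wt b) p u" "N u l" "v < b" "bpow b N (wt b) q v" "N v l"
      by (auto simp: bmult_def[of _ b])
    have "u \<noteq> v"
      using meets_lift[of "wt b" p q i j] ij pq uv by (auto simp: meets_def)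
    then have "{u, v} = {b - 2, b - 1}"
      using W_common_successor[of b u l v] N_eq_W uv l(1) by blast
    then have "B u c" "B v c" using c(2) uv by (auto simp: doubleton_eq_iff)
    then have "bpow n M (Suc (wt b)) i c" "bpow n M (Suc (wt b)) j c"
      using bpow_Suc_iff ij c(1) pq uv by blast+
    then show False using ij(3) c(1) by (auto simp: meets_def)
  qed
  ultimately show ?R by blast
next
  assume ?R
  then obtain r r' where r: "r < n" "\<forall>j<b. A r j = (j = b div 2 - 1)"
    and r': "r' < n" "\<forall>j<b. A r' j = (j = b - 1)"
    and col: "\<not> (\<exists>c<n. \<forall>i<b. B i c = (i = b - 2 \<or> i = b - 1))" by blast
  have "\<not> meets n M (Suc (wt b)) r r'"
  proof
    assume "meets n M (Suc (wt b)) r r'"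
    then obtain c where c: "c < n" "bpow n M (Suc (wt b)) r c" "bpow n M (Suc (wt b)) r' c"
      by (auto simp: meets_def simp del: bpow.simps)
    then obtain u v where u: "u < b" "bpow b N (wt b) (b div 2 - 1) u" "B u c"
      and v: "v < b" "bpow b N (wt b) (b - 1) v" "B v c"
      using bpow_Suc_iff[OF r(1) c(1)] bpow_Suc_iff[OF r'(1) c(1)] r(2) r'(2) by blast
    have lt: "b div 2 - 1 < b" "b - 1 < b" using rank_ge by auto
    have "u \<noteq> v"
    proof
      assume "u = v"
      then have "meets b N (wt b) (b div 2 - 1) (b - 1)" using u v by (auto simp: meets_def)
      then show False using W_not_meets_wt[OF rank_ge] meets_N_iff[OF lt] by blast
    qed
    \<comment> \<open>Two distinct ones in column \<open>c\<close> force it to be the excluded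
      column.\<close>
    then show False using B_column_support[OF c(1) u(3) v(3) _ u(1) v(1)] col c(1) by blast
  qed
  then show ?L using r r' by blast
qed

end

section \<open>From meeting times to the scrambling index\<close>

lemma scrambling_index_eq_Suc_iff:
  assumes "primitive n M" "\<And>i j. i < n \<Longrightarrow> j < n \<Longrightarrow> meets n M (Suc (Suc t)) i j"
  shows "scrambling_index n M = Suc (Suc t) \<longleftrightarrow> (\<exists>i<n. \<exists>j<n. \<not> meets n M (Suc t) i j)"
proof -
  interpret primitive_matrix n M by unfold_locales (rule assms(1))
  define P where "P k \<longleftrightarrow> 0 < k \<and> (\<forall>i<n. \<forall>j<n. meets n M k i j)" for k
  have si: "scrambling_index n M = (LEAST k. P k)"
    by (simp add: scrambling_index_def P_def meets_def)
  have "P (Suc (Suc t))" using assms(2) by (simp add: P_def)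
  \<comment> \<open>Meeting persists in time, so a failure at \<open>Suc t\<close> excludes all
    smaller times as well.\<close>
  have "(LEAST k. P k) = Suc (Suc t) \<longleftrightarrow> \<not> P (Suc t)"
  proof
    assume "(LEAST k. P k) = Suc (Suc t)"
    then show "\<not> P (Suc t)" using not_less_Least[of "Suc t" P] by simp
  next
    assume *: "\<not> P (Suc t)"
    have "Suc (Suc t) \<le> k" if "P k" for k
    proof (rule ccontr)
      assume "\<not> Suc (Suc t) \<le> k"
      then have "k \<le> Suc t" by simp
      then have "P (Suc t)" using that meets_later unfolding P_def by blast
      then show False using * by blast
    qed
    then show "(LEAST k. P k) = Suc (Suc t)" using \<open>P (Suc (Suc t))\<close> by (intro Least_equality) auto
  qed
  then show ?thesis unfolding si P_def by auto
qed

text \<open>For either parity of \<open>m\<close>, \<open>(m + 1) / 2\<close> rounds up to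
  \<open>m div 2 + 1\<close>.\<close>

lemma nat_ceiling_wt: "nat \<lceil>real ((n - 1)\<^sup>2 + 1) / 2\<rceil> = Suc (wt n)"
proof -
  define m where "m = (n - 1)\<^sup>2"
  have "\<lceil>real (m + 1) / 2\<rceil> = int (Suc (m div 2))"
  proof (cases "even m")
    case True
    then obtain k where "m = 2 * k" by blast
    then show ?thesis by (simp add: ceiling_eq_iff add_divide_distrib)
  next
    case False
    then obtain k where "m = 2 * k + 1" using oddE by blast
    then show ?thesis by (simp add: ceiling_eq_iff add_divide_distrib)
  qed
  then show ?thesis by (simp add: wt_def m_def)
qed

theorem theorem2p6:
  fixes n :: nat and M :: bmat
  assumes "primitive n M"
    and "3 \<le> boolean_rank n M" and "boolean_rank n M \<le> n - 1"
  shows "scrambling_index n M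
           = nat \<lceil>real ((boolean_rank n M - 1)^2 + 1) / 2\<rceil> + 1
         \<longleftrightarrow>
         (\<exists>A B. bfactorization n M (boolean_rank n M) A B
            \<and> bmat_eq (boolean_rank n M) (boolean_rank n M)
                 (bmult B n A) (W (boolean_rank n M))
            \<and> (\<exists>r<n. \<forall>j<boolean_rank n M. A r j = (j = boolean_rank n M div 2 - 1))
            \<and> (\<exists>r<n. \<forall>j<boolean_rank n M. A r j = (j = boolean_rank n M - 1))
            \<and> \<not> (\<exists>c<n. \<forall>i<boolean_rank n M.
                     B i c = (i = boolean_rank n M - 2 \<or> i = boolean_rank n M - 1)))"
    (is "?k \<longleftrightarrow> ?F")
proof -
  define t where "t = wt (boolean_rank n M)"
  have k: "?k \<longleftrightarrow> scrambling_index n M = Suc (Suc t)"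
    unfolding nat_ceiling_wt t_def by simp
  have W_index: "scrambling_index n M = Suc (Suc t) \<longleftrightarrow> (\<exists>i<n. \<exists>j<n. \<not> meets n M (Suc t) i j)"
    if "W_factorization n M A B" for A B
    using scrambling_index_eq_Suc_iff[OF assms(1)] W_factorization.meets_Suc_Suc_wt[OF that]
    unfolding t_def by blast
  show ?thesis
  proof
    assume ?k
    then have index: "scrambling_index n M = Suc (Suc t)" using k by blast
    have "\<not> (\<forall>i<n. \<forall>j<n. \<exists>l<n. bpow n M (Suc t) i l \<and> bpow n M (Suc t) j l)"
      using not_less_Least[of "Suc t" "\<lambda>k. k > 0 \<and> (\<forall>i<n. \<forall>j<n. \<exists>l<n. bpow n M k i l \<and> bpow n M k j l)"]
        index unfolding scrambling_index_def by simp
    then obtain i j where ij: "i < n" "j < n" "\<not> meets n M (Suc t) i j"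
      unfolding meets_def by blast
    \<comment> \<open>Any rank factorization serves as a start; relabelling its inner index will
      give the required one.\<close>
    obtain A B where "bfactorization n M (boolean_rank n M) A B"
      using boolean_rank_factorization by blast
    then interpret f: rank_factorization n M A B
      by unfold_locales (use assms(1) in auto)
    interpret N: primitive_matrix f.b f.N by unfold_locales (rule f.primitive_N)
    obtain p q where pq: "p < f.b" "A i p" "q < f.b" "A j q" using f.A_row_nonzero ij by blast
    \<comment> \<open>The failure in \<open>M\<close> descends to \<open>N\<close> one step earlier,
      at the time \<open>t\<close> where the classification of primitive matrices applies.\<close>
    then have "\<not> meets f.b f.N t p q" using f.meets_lift ij by blast
    then obtain \<sigma> where \<sigma>: "bij_betw \<sigma> {..<f.b} {..<f.b}"
      "\<forall>i<f.b. \<forall>j<f.b. f.N (\<sigma> i) (\<sigma> j) = W f.b i j"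
      using N.not_meets_imp_W[OF assms(2) pq(1,3)] unfolding t_def by blast
    define A' where "A' i p = A i (\<sigma> p)" for i p
    define B' where "B' p = B (\<sigma> p)" for p
    have "rank_factorization n M A' B'" unfolding A'_def B'_def by (rule f.relabel[OF \<sigma>(1)])
    then interpret g: rank_factorization n M A' B' .
    have "bmult B' n A' x y = f.N (\<sigma> x) (\<sigma> y)" for x y
      by (simp add: bmult_def A'_def B'_def)
    then have "bmat_eq f.b f.b (bmult B' n A') (W f.b)"
      using \<sigma>(2) by (simp add: bmat_eq_def)
    then interpret g: W_factorization n M A' B'
      using assms(2) by unfold_locales
    show ?F using g.fact g.BA g.not_meets_Suc_wt_iff ij unfolding t_def by blast
  next
    assume ?F
    then obtain A B where AB: "bfactorization n M (boolean_rank n M) A B"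
      "bmat_eq (boolean_rank n M) (boolean_rank n M) (bmult B n A) (W (boolean_rank n M))"
      "\<exists>r<n. \<forall>j<boolean_rank n M. A r j = (j = boolean_rank n M div 2 - 1)"
      "\<exists>r<n. \<forall>j<boolean_rank n M. A r j = (j = boolean_rank n M - 1)"
      "\<not> (\<exists>c<n. \<forall>i<boolean_rank n M. B i c = (i = boolean_rank n M - 2 \<or> i = boolean_rank n M - 1))"
      by blast
    then interpret W_factorization n M A B
      by unfold_locales (use assms in auto)
    have "\<exists>i<n. \<exists>j<n. \<not> meets n M (Suc t) i j" using not_meets_Suc_wt_iff AB unfolding t_def by blast
    then show ?k using k W_index W_factorization_axioms by blast
  qed
qed

end
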